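(* Let $M$ be a Garside monoid with Garside element $\Delta$ and set of atoms $S$, such that for every subset $S_1\subset S$ the right-lcm of $S_1$ equals $\Delta_{P_1}:=H_{P_1}(\Delta)$, where $P_1$ is the smallest standard parabolic submonoid of $M$ containing $S_1$. Assume that some positive power of $\Delta$ is central in $M$, and that for every standard parabolic submonoid $P$ some positive power of $\Delta_P$ is central in $P$. Let $G$ be the group of fractions of $M$. Let $K=G_P^b$ be a parabolic subgroup of $G$, where $P$ is a standard parabolic submonoid and $b\in M$. Define $b'\in M$ by $H_P(b)\,R_P(T_P(b))\,b'=b$ and define $Q:=P^{R_P(T_P(b))}$ (a standard parabolic submonoid). Let $\Delta_Q^k$ ($k>0$) be the smallest power of $\Delta_Q$ that is central in $Q$. Then $b'^{-1}\Delta_Q^k b'$ is the reduced fraction of $z_K$; that is, $z_K=b'^{-1}\cdot(\Delta_Q^k b')$ and the left-gcd of $b'$ and $\Delta_Q^kb'$ is $1$.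
   Context: A Garside monoid $M$ is a left- and right-cancellative monoid that is Noetherian (there is no infinite sequence in which each term is a proper factor of the previous one; a factor of $x$ is a left-divisor of a right-divisor of $x$), in which any two elements have left- and right-gcd's and lcm's (so $1$ is the only invertible element), together with a Garside element $\Delta$: an element whose left-divisors and right-divisors coincide and generate $M$. Write $a\preccurlyeq b$ if $a$ left-divides $b$; the left-gcd is the greatest common left-divisor and the right-lcm is the least common right-multiple (with respect to $\preccurlyeq$). Atoms are the elements different from $1$ with no proper nontrivial divisors; $S$ denotes the set of atoms. A standard parabolic submonoid $P$ of $M$ is a submonoid closed under factors such that every $g\in M$ has a greatest left-divisor lying in $P$ (denoted $H_P(g)$, the left $P$-head) and a greatest right-divisor lying in $P$. Any intersection of standard parabolic submonoids is one, so the smallest standard parabolic submonoid containing a given set exists. $T_P(g)$ is defined by $g=H_P(g)T_P(g)$; $g$ is $P$-reduced if $H_P(g)=1$. Put $\Delta_P:=H_P(\Delta)$, which is a Garside element of $P$. For $b,g$ in $G$, $b^g:=g^{-1}bg$. For $b,g\in M$, one says that $b^g$ is defined if $g\preccurlyeq bg$ (i.e. $b^g\in M$); $P^g$ is defined if $p^g$ is defined for all $p\in P$, and then $P^g=\{p^g: p\in P\}$. A $P$-ribbon is a $P$-reduced element $g\in M$ such that $P^g$ is defined; in that case $P^g$ is a standard parabolic submonoid. For a $P$-reduced $g\in M$, $R_P(g)$ denotes the unique maximal left-divisor of $g$ which is a $P$-ribbon. $G$ is the group of fractions of $M$ ($M$ embeds in $G$). $G_P$ is the group of fractions of $P$, the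 subgroup of $G$ generated by $P$. Parabolic subgroups are the conjugates $G_P^g$ ($g\in G$). For a parabolic subgroup $K=G_P^g$, $z_K:=(\Delta_P^k)^g$, where $\Delta_P^k$, $k>0$, is the smallest power of $\Delta_P$ central in $P$; it depends only on $K$. A (left) reduced fraction for $x\in G$ is an expression $x=p^{-1}q$ with $p,q\in M$ having trivial left-gcd; it is unique. *)

theory Defs
  imports "HOL.Hull" "HOL-Algebra.Divisibility" "HOL-Algebra.Generated_Groups"
begin

text \<open>
  The library predicate \<open>a divides\<^bsub>M\<^esub> b\<close> says \<open>b = a \<otimes>\<^bsub>M\<^esub> c\<close> for some \<open>c\<close> of the carrier. For a
  non-commutative monoid it is left divisibility, so \<open>gcdof\<close> is the left-gcd and \<open>lcmof\<close> is the
  right-lcm (least common right-multiple).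
\<close>

definition right_divides :: "('a, 'm) monoid_scheme \<Rightarrow> 'a \<Rightarrow> 'a \<Rightarrow> bool" where
  "right_divides M a b \<longleftrightarrow> (\<exists>c\<in>carrier M. b = c \<otimes>\<^bsub>M\<^esub> a)"

definition is_greatest :: "('a \<Rightarrow> 'a \<Rightarrow> bool) \<Rightarrow> 'a set \<Rightarrow> 'a \<Rightarrow> bool" where
  "is_greatest R A x \<longleftrightarrow> x \<in> A \<and> (\<forall>y\<in>A. R y x)"

definition is_least :: "('a \<Rightarrow> 'a \<Rightarrow> bool) \<Rightarrow> 'a set \<Rightarrow> 'a \<Rightarrow> bool" where
  "is_least R A x \<longleftrightarrow> x \<in> A \<and> (\<forall>y\<in>A. R x y)"

definition is_right_gcd :: "('a, 'm) monoid_scheme \<Rightarrow> 'a \<Rightarrow> 'a \<Rightarrow> 'a \<Rightarrow> bool" where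
  "is_right_gcd M d a b \<longleftrightarrow>
     is_greatest (right_divides M)
       {x \<in> carrier M. right_divides M x a \<and> right_divides M x b} d"

definition is_left_lcm :: "('a, 'm) monoid_scheme \<Rightarrow> 'a \<Rightarrow> 'a \<Rightarrow> 'a \<Rightarrow> bool" where
  "is_left_lcm M m a b \<longleftrightarrow>
     is_least (right_divides M)
       {x \<in> carrier M. right_divides M a x \<and> right_divides M b x} m"

definition is_right_lcm_set :: "('a, 'm) monoid_scheme \<Rightarrow> 'a set \<Rightarrow> 'a \<Rightarrow> bool" where
  "is_right_lcm_set M X m \<longleftrightarrow>
     is_least (\<lambda>x y. x divides\<^bsub>M\<^esub> y) {x \<in> carrier M. \<forall>s\<in>X. s divides\<^bsub>M\<^esub> x} m"

definition is_factor :: "('a, 'm) monoid_scheme \<Rightarrow> 'a \<Rightarrow> 'a \<Rightarrow> bool" where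
  "is_factor M y x \<longleftrightarrow> (\<exists>d\<in>carrier M. right_divides M d x \<and> y divides\<^bsub>M\<^esub> d)"

definition noetherian_monoid :: "('a, 'm) monoid_scheme \<Rightarrow> bool" where
  "noetherian_monoid M \<longleftrightarrow>
     \<not> (\<exists>f :: nat \<Rightarrow> 'a. (\<forall>n. f n \<in> carrier M) \<and>
          (\<forall>n. is_factor M (f (Suc n)) (f n) \<and> f (Suc n) \<noteq> f n))"

definition atoms :: "('a, 'm) monoid_scheme \<Rightarrow> 'a set" where
  "atoms M = {a \<in> carrier M. a \<noteq> \<one>\<^bsub>M\<^esub> \<and>
     (\<forall>d\<in>carrier M. d divides\<^bsub>M\<^esub> a \<or> right_divides M d a \<longrightarrow> d = \<one>\<^bsub>M\<^esub> \<or> d = a)}"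

definition garside_element :: "('a, 'm) monoid_scheme \<Rightarrow> 'a \<Rightarrow> bool" where
  "garside_element M \<Delta> \<longleftrightarrow> \<Delta> \<in> carrier M \<and>
     {d \<in> carrier M. d divides\<^bsub>M\<^esub> \<Delta>} = {d \<in> carrier M. right_divides M d \<Delta>} \<and>
     (\<lambda>N. submonoid N M) hull {d \<in> carrier M. d divides\<^bsub>M\<^esub> \<Delta>} = carrier M"

locale garside_monoid = monoid_cancel M for M (structure) and \<Delta> +
  assumes noetherian: "noetherian_monoid M"
    and left_gcd_exists:
      "\<lbrakk>a \<in> carrier M; b \<in> carrier M\<rbrakk> \<Longrightarrow> \<exists>d\<in>carrier M. d gcdof a b"
    and right_lcm_exists:
      "\<lbrakk>a \<in> carrier M; b \<in> carrier M\<rbrakk> \<Longrightarrow> \<exists>m\<in>carrier M. m lcmof a b"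
    and right_gcd_exists:
      "\<lbrakk>a \<in> carrier M; b \<in> carrier M\<rbrakk> \<Longrightarrow> \<exists>d. is_right_gcd M d a b"
    and left_lcm_exists:
      "\<lbrakk>a \<in> carrier M; b \<in> carrier M\<rbrakk> \<Longrightarrow> \<exists>m. is_left_lcm M m a b"
    and garside: "garside_element M \<Delta>"

text \<open>
  \<open>M\<close> is regarded as a subset of its group of fractions. Left fractions suffice, since \<open>M\<close> has both
  left and right common multiples.
\<close>

definition group_of_fractions ::
    "('a, 'm) monoid_scheme \<Rightarrow> ('a, 'g) monoid_scheme \<Rightarrow> bool" where
  "group_of_fractions M G \<longleftrightarrow> group G \<and> submonoid (carrier M) G \<and>
     \<one>\<^bsub>M\<^esub> = \<one>\<^bsub>G\<^esub> \<and> (\<forall>a\<in>carrier M. \<forall>b\<in>carrier M. a \<otimes>\<^bsub>M\<^esub> b = a \<otimes>\<^bsub>G\<^esub> b) \<and>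
     (\<forall>x\<in>carrier G. \<exists>a\<in>carrier M. \<exists>b\<in>carrier M. x = inv\<^bsub>G\<^esub> a \<otimes>\<^bsub>G\<^esub> b)"

definition standard_parabolic :: "('a, 'm) monoid_scheme \<Rightarrow> 'a set \<Rightarrow> bool" where
  "standard_parabolic M P \<longleftrightarrow> submonoid P M \<and>
     (\<forall>x\<in>P. \<forall>y\<in>carrier M. is_factor M y x \<longrightarrow> y \<in> P) \<and>
     (\<forall>g\<in>carrier M. \<exists>h. is_greatest (\<lambda>x y. x divides\<^bsub>M\<^esub> y) {x \<in> P. x divides\<^bsub>M\<^esub> g} h) \<and>
     (\<forall>g\<in>carrier M. \<exists>h. is_greatest (right_divides M) {x \<in> P. right_divides M x g} h)"

definition head :: "('a, 'm) monoid_scheme \<Rightarrow> 'a set \<Rightarrow> 'a \<Rightarrow> 'a" where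
  "head M P g = (THE h. is_greatest (\<lambda>x y. x divides\<^bsub>M\<^esub> y) {x \<in> P. x divides\<^bsub>M\<^esub> g} h)"

definition tail :: "('a, 'm) monoid_scheme \<Rightarrow> 'a set \<Rightarrow> 'a \<Rightarrow> 'a" where
  "tail M P g = (THE t. t \<in> carrier M \<and> g = head M P g \<otimes>\<^bsub>M\<^esub> t)"

definition reduced :: "('a, 'm) monoid_scheme \<Rightarrow> 'a set \<Rightarrow> 'a \<Rightarrow> bool" where
  "reduced M P g \<longleftrightarrow> g \<in> carrier M \<and> head M P g = \<one>\<^bsub>M\<^esub>"

definition ribbon :: "('a, 'm) monoid_scheme \<Rightarrow> 'a set \<Rightarrow> 'a \<Rightarrow> bool" where
  "ribbon M P g \<longleftrightarrow> reduced M P g \<and> (\<forall>p\<in>P. g divides\<^bsub>M\<^esub> (p \<otimes>\<^bsub>M\<^esub> g))"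

definition max_ribbon :: "('a, 'm) monoid_scheme \<Rightarrow> 'a set \<Rightarrow> 'a \<Rightarrow> 'a" where
  "max_ribbon M P g = (THE r. ribbon M P r \<and> r divides\<^bsub>M\<^esub> g \<and>
     (\<forall>s. ribbon M P s \<and> s divides\<^bsub>M\<^esub> g \<and> r divides\<^bsub>M\<^esub> s \<longrightarrow> s = r))"

definition conj_by :: "('a, 'g) monoid_scheme \<Rightarrow> 'a \<Rightarrow> 'a \<Rightarrow> 'a" where
  "conj_by G g x = inv\<^bsub>G\<^esub> g \<otimes>\<^bsub>G\<^esub> x \<otimes>\<^bsub>G\<^esub> g"

definition centralizes :: "('a, 'm) monoid_scheme \<Rightarrow> 'a set \<Rightarrow> 'a \<Rightarrow> bool" where
  "centralizes M P z \<longleftrightarrow> (\<forall>x\<in>P. z \<otimes>\<^bsub>M\<^esub> x = x \<otimes>\<^bsub>M\<^esub> z)"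

definition least_central_power :: "('a, 'm) monoid_scheme \<Rightarrow> 'a set \<Rightarrow> 'a \<Rightarrow> 'a" where
  "least_central_power M P d =
     d [^]\<^bsub>M\<^esub> (LEAST k::nat. 0 < k \<and> centralizes M P (d [^]\<^bsub>M\<^esub> k))"

text \<open>
  The element \<open>z\<^sub>K\<close>, defined from the subgroup \<open>K\<close> alone: the definite description ranges over all
  presentations of \<open>K\<close> as a conjugate of the subgroup generated by a standard parabolic submonoid.
\<close>

definition parabolic_z ::
    "('a, 'm) monoid_scheme \<Rightarrow> 'a \<Rightarrow> ('a, 'g) monoid_scheme \<Rightarrow> 'a set \<Rightarrow> 'a" where
  "parabolic_z M \<Delta> G K =
     (THE z. \<exists>P g. standard_parabolic M P \<and> g \<in> carrier G \<and>
        K = conj_by G g ` generate G P \<and>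
        z = conj_by G g (least_central_power M P (head M P \<Delta>)))"

definition reduced_fraction ::
    "('a, 'm) monoid_scheme \<Rightarrow> ('a, 'g) monoid_scheme \<Rightarrow> 'a \<Rightarrow> 'a \<Rightarrow> 'a \<Rightarrow> bool" where
  "reduced_fraction M G x p q \<longleftrightarrow> p \<in> carrier M \<and> q \<in> carrier M \<and>
     x = inv\<^bsub>G\<^esub> p \<otimes>\<^bsub>G\<^esub> q \<and> \<one>\<^bsub>M\<^esub> gcdof\<^bsub>M\<^esub> p q"

end

theory Submission
  imports Defs
begin

text \<open>
  Write \<open>z\<^sub>P\<close> for the least central power of \<open>\<Delta>\<^sub>P\<close>, and split \<open>b = h r b'\<close> with \<open>h\<close> the \<open>P\<close>-head of \<open>b\<close>
  and \<open>r\<close> the maximal ribbon of the tail. Conjugation by \<open>h \<in> P\<close> fixes \<open>G\<^sub>P\<close> and \<open>z\<^sub>P\<close>, and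
  conjugation by \<open>r\<close> carries \<open>(P, \<Delta>\<^sub>P)\<close> to \<open>(Q, \<Delta>\<^sub>Q)\<close>. So \<open>K\<close> is the conjugate of \<open>G\<^sub>Q\<close> by \<open>b'\<close>, and
  \<open>z\<^sub>P\<close> conjugated by \<open>b\<close> is the fraction with denominator \<open>b'\<close> and numerator \<open>z\<^sub>Q b'\<close>. It remains to see
  that this fraction is reduced and that \<open>z\<^sub>K\<close> depends on \<open>K\<close> alone.

  Everything rests on one construction (\<open>elementary_ribbon\<close>). Let \<open>u \<noteq> \<one>\<close> be \<open>P\<close>-reduced, \<open>s\<close> an atom
  dividing \<open>u\<close> on the left, and \<open>P\<^sub>1\<close> the smallest standard parabolic submonoid containing \<open>P\<close> and \<open>s\<close>.
  The hypothesis on lcms of atoms says that \<open>\<Delta>\<close> of \<open>P\<^sub>1\<close> is the right-lcm of \<open>\<Delta>\<^sub>P\<close> and \<open>s\<close>, hence of the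
  form \<open>\<Delta>\<^sub>P d\<close>, and \<open>d\<close> divides every \<open>x\<close> for which \<open>u\<close> divides \<open>\<Delta>\<^sub>P x\<close>. Conjugation by \<open>d\<close> undoes
  the automorphism \<open>\<Delta>\<^sub>P\<close> induces on \<open>P\<close> and then applies the one that \<open>\<Delta>\<^sub>P d\<close> induces on \<open>P\<^sub>1\<close>; so \<open>d\<close>
  is a \<open>P\<close>-ribbon, and it sends \<open>P\<close> to a standard parabolic submonoid and \<open>\<Delta>\<^sub>P\<close> to the Garside element
  of that submonoid. A nontrivial ribbon \<open>u\<close> divides \<open>\<Delta>\<^sub>P u\<close>, hence starts with such a \<open>d\<close>;
  by Noetherian induction all ribbons behave like the elementary ones (\<open>ribbon_conjugate\<close>).

  Reducedness (\<open>coprime_central_mult\<close>): if some \<open>y \<noteq> \<one>\<close> divided \<open>b'\<close> and \<open>\<Delta>\<^sub>Q\<^sup>k b'\<close>, then the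
  construction would yield a nontrivial \<open>Q\<close>-ribbon dividing \<open>\<Delta>\<^sub>Q\<^sup>k\<^sup>-\<^sup>1 b'\<close>, from this one another dividing
  \<open>\<Delta>\<^sub>Q\<^sup>k\<^sup>-\<^sup>2 b'\<close>, and finally one dividing \<open>b'\<close>; appended to \<open>r\<close> it would contradict the maximality of \<open>r\<close>.

  Independence (\<open>conj_by_central_elt\<close>): it is enough to treat \<open>m\<close> conjugating \<open>G\<^sub>P\<close> to \<open>G\<close> of another
  standard parabolic \<open>P'\<close>, and, after multiplication by a central element, \<open>m \<in> M\<close>. Decompose \<open>m\<close>
  as above, with last factor \<open>c\<close>. The element \<open>z\<^sub>P\<close> conjugated by \<open>m\<close> lies in the group generated
  by \<open>P'\<close> and has a reduced fraction with denominator \<open>c\<close>, which forces \<open>c \<in> P'\<close>. Then \<open>Q\<close> and \<open>P'\<close>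
  generate the same group, so \<open>Q = P'\<close>, and conjugation by \<open>c\<close> fixes the central element of \<open>P'\<close>.
\<close>

section \<open>Factors and atoms\<close>

context garside_monoid
begin

lemma is_factorI:
  assumes "u \<in> carrier M" "y \<in> carrier M" "v \<in> carrier M" "x = u \<otimes> (y \<otimes> v)"
  shows "is_factor M y x"
  using assms unfolding is_factor_def right_divides_def factor_def by blast

lemma is_factorE:
  assumes "is_factor M y x"
  obtains u v where "u \<in> carrier M" "v \<in> carrier M" "x = u \<otimes> (y \<otimes> v)"
  using assms unfolding is_factor_def right_divides_def factor_def by blast

lemma left_factor: "\<lbrakk>u \<in> carrier M; v \<in> carrier M\<rbrakk> \<Longrightarrow> is_factor M u (u \<otimes> v)"
  by (rule is_factorI[of \<one> u v]) auto

lemma right_factor: "\<lbrakk>u \<in> carrier M; v \<in> carrier M\<rbrakk> \<Longrightarrow> is_factor M v (u \<otimes> v)"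
  by (rule is_factorI[of u v \<one>]) auto

lemma divides_is_factor: "\<lbrakk>a divides b; a \<in> carrier M\<rbrakk> \<Longrightarrow> is_factor M a b"
  by (auto simp: factor_def intro: left_factor)

lemma right_divides_is_factor: "\<lbrakk>right_divides M a b; a \<in> carrier M\<rbrakk> \<Longrightarrow> is_factor M a b"
  by (auto simp: right_divides_def intro: right_factor)

lemma right_divides_refl: "a \<in> carrier M \<Longrightarrow> right_divides M a a"
  unfolding right_divides_def by (rule bexI[of _ \<one>]) auto

lemma right_divides_trans:
  assumes "right_divides M a b" "right_divides M b c" "a \<in> carrier M"
  shows "right_divides M a c"
  using assms unfolding right_divides_def by (metis m_assoc m_closed)

text \<open>
  Otherwise \<open>x, y, x, y, \<dots>\<close> would be an infinite chain of proper factors. In particular there are no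
  nontrivial units, so left-gcds, lcms and heads are unique and not merely unique up to associates.
\<close>

lemma is_factor_antisym:
  assumes "is_factor M x y" "is_factor M y x" "x \<in> carrier M" "y \<in> carrier M"
  shows "x = y"
proof (rule ccontr)
  assume "x \<noteq> y"
  define f where "f n = (if even n then x else y)" for n :: nat
  have "\<forall>n. f n \<in> carrier M" "\<forall>n. is_factor M (f (Suc n)) (f n) \<and> f (Suc n) \<noteq> f n"
    using assms \<open>x \<noteq> y\<close> by (auto simp: f_def)
  then show False
    using noetherian unfolding noetherian_monoid_def by blast
qed

lemma divides_antisym:
  "\<lbrakk>a divides b; b divides a; a \<in> carrier M; b \<in> carrier M\<rbrakk> \<Longrightarrow> a = b"
  by (meson divides_is_factor is_factor_antisym)

lemma divides_one: "\<lbrakk>a divides \<one>; a \<in> carrier M\<rbrakk> \<Longrightarrow> a = \<one>"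
  by (rule divides_antisym) (auto simp: factor_def)

lemma one_divides: "a \<in> carrier M \<Longrightarrow> \<one> divides a"
  by (auto simp: factor_def)

lemma mult_eq_left_iff: "\<lbrakk>a \<in> carrier M; b \<in> carrier M\<rbrakk> \<Longrightarrow> a \<otimes> b = a \<longleftrightarrow> b = \<one>"
  using l_cancel[of a b \<one>] by auto

lemma mult_eq_right_iff: "\<lbrakk>a \<in> carrier M; b \<in> carrier M\<rbrakk> \<Longrightarrow> a \<otimes> b = b \<longleftrightarrow> a = \<one>"
  using r_cancel[of a b \<one>] by auto

lemma proper_factor_wf:
  "wf {(y, x). x \<in> carrier M \<and> y \<in> carrier M \<and> is_factor M y x \<and> y \<noteq> x}" (is "wf ?R")
proof (rule ccontr)
  assume "\<not> wf ?R"
  then obtain f where "\<forall>n. (f (Suc n), f n) \<in> ?R"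
    unfolding wf_iff_no_infinite_down_chain by blast
  then show False
    using noetherian unfolding noetherian_monoid_def by blast
qed

lemma factor_induct [consumes 1, case_names step]:
  assumes "x \<in> carrier M"
    and "\<And>x. x \<in> carrier M \<Longrightarrow>
      (\<And>y. y \<in> carrier M \<Longrightarrow> is_factor M y x \<Longrightarrow> y \<noteq> x \<Longrightarrow> R y) \<Longrightarrow> R x"
  shows "R x"
proof -
  have "x \<in> carrier M \<longrightarrow> R x"
    by (induction rule: wf_induct[OF proper_factor_wf]) (use assms(2) in blast)
  with assms(1) show ?thesis by blast
qed

text \<open>
  This is the form in which the Noetherian hypothesis yields maximal divisors: one minimises a cofactor.
\<close>

lemma factor_minimal_exists:
  assumes "A \<subseteq> carrier M" "a \<in> A"
  obtains m where "m \<in> A" "\<And>y. y \<in> A \<Longrightarrow> is_factor M y m \<Longrightarrow> y = m"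
proof (rule wfE_min[OF proper_factor_wf assms(2)])
  fix m
  assume m: "m \<in> A"
    and min: "\<And>y. (y, m) \<in> {(y, x). x \<in> carrier M \<and> y \<in> carrier M \<and> is_factor M y x \<and> y \<noteq> x}
      \<Longrightarrow> y \<notin> A"
  have "y = m" if "y \<in> A" "is_factor M y m" for y
    using min[of y] that m assms(1) by auto
  with m that show thesis by blast
qed

lemma atom_divides:
  assumes "x \<in> carrier M" "x \<noteq> \<one>"
  obtains a where "a \<in> atoms M" "a divides x"
proof -
  have "x \<noteq> \<one> \<longrightarrow> (\<exists>a\<in>atoms M. a divides x)"
    using assms(1)
  proof (induction x rule: factor_induct)
    case (step x)
    show ?case
    proof (intro impI, cases "x \<in> atoms M")
      case True
      with step.hyps show "\<exists>a\<in>atoms M. a divides x" by auto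
    next
      case False
      assume "x \<noteq> \<one>"
      with False step.hyps obtain d where d: "d \<in> carrier M" "d \<noteq> \<one>" "d \<noteq> x"
          "d divides x \<or> right_divides M d x"
        unfolding atoms_def by blast
      \<comment> \<open>Whichever side \<open>d\<close> is on, some left-divisor \<open>c\<close> of \<open>x\<close> is proper and nontrivial.\<close>
      obtain c where c: "c \<in> carrier M" "c \<noteq> \<one>" "c \<noteq> x" "c divides x"
      proof (cases "d divides x")
        case True
        with d that show ?thesis by blast
      next
        case False
        with d obtain c where "c \<in> carrier M" "x = c \<otimes> d"
          unfolding right_divides_def by blast
        moreover have "c \<noteq> \<one>" "c \<noteq> x"
          using \<open>c \<in> carrier M\<close> \<open>x = c \<otimes> d\<close> d mult_eq_left_iff[of c d] by auto
        moreover have "c divides x"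
          using \<open>x = c \<otimes> d\<close> d by blast
        ultimately show ?thesis using that[of c] by blast
      qed
      then obtain a where "a \<in> atoms M" "a divides c"
        using step.IH[of c] divides_is_factor by blast
      with c show "\<exists>a\<in>atoms M. a divides x"
        using divides_trans unfolding atoms_def by blast
    qed
  qed
  with assms that show thesis by blast
qed

lemma atomsD: "a \<in> atoms M \<Longrightarrow> a \<in> carrier M \<and> a \<noteq> \<one>"
  by (simp add: atoms_def)

text \<open>
  Left multiplication by \<open>f\<close> preserves left-gcds, so the left-gcd of \<open>f a\<close> and \<open>f b\<close> is \<open>f\<close>.
\<close>

lemma coprime_mult_divides:
  assumes ab: "\<one> gcdof a b" and c: "c divides (f \<otimes> a)" "c divides (f \<otimes> b)"
    and carr: "a \<in> carrier M" "b \<in> carrier M" "c \<in> carrier M" "f \<in> carrier M"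
  shows "c divides f"
proof -
  obtain g where g: "g \<in> carrier M" "g gcdof (f \<otimes> a) (f \<otimes> b)"
    using left_gcd_exists carr by blast
  have "f divides g" using g(2) carr unfolding isgcd_def by blast
  then obtain t where t: "t \<in> carrier M" "g = f \<otimes> t" by blast
  have "t divides a" "t divides b"
    using g(2) t carr by (auto simp: isgcd_def)
  then have "t = \<one>" using ab t(1) divides_one unfolding isgcd_def by blast
  then show ?thesis
    using g(2) c carr t unfolding isgcd_def by auto
qed

section \<open>Standard parabolic submonoids and heads\<close>

lemma parabolicD:
  assumes "standard_parabolic M P"
  shows parabolic_carrier: "x \<in> P \<Longrightarrow> x \<in> carrier M"
    and parabolic_one: "\<one> \<in> P"
    and parabolic_mult: "\<lbrakk>x \<in> P; y \<in> P\<rbrakk> \<Longrightarrow> x \<otimes> y \<in> P"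
    and parabolic_factor: "\<lbrakk>x \<in> P; y \<in> carrier M; is_factor M y x\<rbrakk> \<Longrightarrow> y \<in> P"
proof -
  interpret P: submonoid P M
    using assms by (simp add: standard_parabolic_def)
  show "x \<in> P \<Longrightarrow> x \<in> carrier M" "\<one> \<in> P" "\<lbrakk>x \<in> P; y \<in> P\<rbrakk> \<Longrightarrow> x \<otimes> y \<in> P"
    by auto
  show "\<lbrakk>x \<in> P; y \<in> carrier M; is_factor M y x\<rbrakk> \<Longrightarrow> y \<in> P"
    using assms unfolding standard_parabolic_def by blast
qed

lemma parabolic_mult_iff:
  assumes "standard_parabolic M P" "x \<in> carrier M" "y \<in> carrier M"
  shows "x \<otimes> y \<in> P \<longleftrightarrow> x \<in> P \<and> y \<in> P"
proof
  assume "x \<otimes> y \<in> P"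
  with assms show "x \<in> P \<and> y \<in> P"
    using parabolic_factor[OF assms(1)] left_factor[of x y] right_factor[of x y] by simp
qed (use parabolic_mult[OF assms(1)] in simp)

text \<open>
  Closure under factors makes every element of \<open>P\<close> a product of atoms of \<open>M\<close> that lie in \<open>P\<close>.
\<close>

lemma parabolic_induct [consumes 2, case_names one mult]:
  assumes "standard_parabolic M P" "x \<in> P"
    and "R \<one>"
    and "\<And>a y. a \<in> atoms M \<Longrightarrow> a \<in> P \<Longrightarrow> y \<in> P \<Longrightarrow> R y \<Longrightarrow> R (a \<otimes> y)"
  shows "R x"
proof -
  have "x \<in> P \<longrightarrow> R x"
    using parabolic_carrier[OF assms(1,2)]
  proof (induction x rule: factor_induct)
    case (step x)
    show ?case
    proof (intro impI, cases "x = \<one>")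
      case False
      assume "x \<in> P"
      obtain a where a: "a \<in> atoms M" "a divides x"
        using atom_divides step.hyps False by blast
      then obtain y where y: "y \<in> carrier M" "x = a \<otimes> y"
        unfolding factor_def by blast
      have "a \<in> carrier M" "a \<noteq> \<one>"
        using atomsD a by auto
      then have "a \<in> P" "y \<in> P" "y \<noteq> x" "is_factor M y x"
        using \<open>x \<in> P\<close> y parabolic_mult_iff[OF assms(1)] mult_eq_right_iff[of a y] right_factor
        by auto
      then show "R x"
        using step.IH y a assms(4) by blast
    qed (simp add: assms(3))
  qed
  with assms(2) show ?thesis by blast
qed

lemma greatest_divisor_unique:
  assumes "is_greatest (\<lambda>x y. x divides y) {x \<in> P. x divides g} h"
    and "is_greatest (\<lambda>x y. x divides y) {x \<in> P. x divides g} k" and "P \<subseteq> carrier M"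
  shows "h = k"
  using assms unfolding is_greatest_def by (auto intro!: divides_antisym)

lemma head_eqI:
  assumes "P \<subseteq> carrier M" "h \<in> P" "h divides g" "\<And>x. x \<in> P \<Longrightarrow> x divides g \<Longrightarrow> x divides h"
  shows "head M P g = h"
  unfolding head_def
proof (rule the_equality)
  show gr: "is_greatest (\<lambda>x y. x divides y) {x \<in> P. x divides g} h"
    using assms unfolding is_greatest_def by auto
  fix k assume "is_greatest (\<lambda>x y. x divides y) {x \<in> P. x divides g} k"
  with gr assms(1) show "k = h" using greatest_divisor_unique by blast
qed

lemma head:
  assumes "standard_parabolic M P" "g \<in> carrier M"
  shows head_mem: "head M P g \<in> P" and head_divides: "head M P g divides g"
    and head_greatest: "\<lbrakk>x \<in> P; x divides g\<rbrakk> \<Longrightarrow> x divides head M P g"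
proof -
  obtain h where h: "is_greatest (\<lambda>x y. x divides y) {x \<in> P. x divides g} h"
    using assms unfolding standard_parabolic_def by blast
  then have "head M P g = h"
    using parabolic_carrier[OF assms(1)] by (intro head_eqI) (auto simp: is_greatest_def)
  with h show "head M P g \<in> P" "head M P g divides g" "\<lbrakk>x \<in> P; x divides g\<rbrakk> \<Longrightarrow> x divides head M P g"
    by (auto simp: is_greatest_def)
qed

lemma reduced_carrier: "reduced M P g \<Longrightarrow> g \<in> carrier M"
  by (simp add: reduced_def)

lemma reducedD:
  assumes "standard_parabolic M P" "reduced M P g" "p \<in> P" "p divides g"
  shows "p = \<one>"
proof -
  have "p divides head M P g"
    using assms by (intro head_greatest) (auto simp: reduced_def)
  with assms show ?thesis
    using divides_one[of p] parabolic_carrier[of P p] by (simp add: reduced_def)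
qed

lemma reducedI:
  assumes "standard_parabolic M P" "g \<in> carrier M" "\<And>p. p \<in> P \<Longrightarrow> p divides g \<Longrightarrow> p = \<one>"
  shows "reduced M P g"
  using assms(2) assms(3)[OF head_mem[OF assms(1,2)] head_divides[OF assms(1,2)]]
  by (simp add: reduced_def)

lemma reduced_divisor:
  assumes "standard_parabolic M P" "reduced M P g" "d divides g" "d \<in> carrier M"
  shows "reduced M P d"
proof (rule reducedI[OF assms(1,4)])
  fix p assume "p \<in> P" "p divides d"
  then show "p = \<one>"
    using assms divides_trans[of p d g] parabolic_carrier[OF assms(1)] reducedD[OF assms(1,2)]
    by simp
qed

lemma parabolic_whole: "standard_parabolic M (carrier M)"
proof -
  have "submonoid (carrier M) M" by unfold_locales auto
  moreover have "is_greatest (\<lambda>x y. x divides y) {x \<in> carrier M. x divides g} g"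
    "is_greatest (right_divides M) {x \<in> carrier M. right_divides M x g} g"
    if "g \<in> carrier M" for g
    using that right_divides_refl unfolding is_greatest_def by auto
  ultimately show ?thesis
    unfolding standard_parabolic_def by blast
qed

text \<open>
  Start from \<open>g\<close> and keep passing to a divisor that still lies above all divisors of \<open>g\<close> in the
  intersection. By Noetherianity there is a minimal such divisor \<open>h\<close>; taking its greatest divisor
  in any \<open>P \<in> F\<close> cannot make it smaller, so \<open>h \<in> P\<close>. The relation \<open>R\<close> stands for left or
  right divisibility.
\<close>

lemma greatest_in_Inter:
  assumes refl: "\<And>x. x \<in> carrier M \<Longrightarrow> R x x"
    and trans: "\<And>x y z. R x y \<Longrightarrow> R y z \<Longrightarrow> x \<in> carrier M \<Longrightarrow> R x z"
    and factor: "\<And>x y. R x y \<Longrightarrow> x \<in> carrier M \<Longrightarrow> is_factor M x y"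
    and greatest: "\<And>P g. P \<in> F \<Longrightarrow> g \<in> carrier M \<Longrightarrow> \<exists>h. is_greatest R {x \<in> P. R x g} h"
    and F: "\<And>P. P \<in> F \<Longrightarrow> P \<subseteq> carrier M" "F \<noteq> {}"
    and g: "g \<in> carrier M"
  shows "\<exists>h. is_greatest R {x \<in> \<Inter>F. R x g} h"
proof -
  let ?A = "{h \<in> carrier M. R h g \<and> (\<forall>x\<in>\<Inter>F. R x g \<longrightarrow> R x h)}"
  have "g \<in> ?A" using g refl by blast
  then obtain h where h: "h \<in> ?A" and min: "\<And>y. y \<in> ?A \<Longrightarrow> is_factor M y h \<Longrightarrow> y = h"
    using factor_minimal_exists[of ?A g] by blast
  have "h \<in> P" if "P \<in> F" for P
  proof -
    obtain k where k: "is_greatest R {x \<in> P. R x h} k"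
      using greatest \<open>P \<in> F\<close> h by blast
    then have kP: "k \<in> P" "R k h" by (auto simp: is_greatest_def)
    have "k \<in> carrier M" using kP F \<open>P \<in> F\<close> by blast
    moreover have "R k g" using kP h trans calculation by blast
    moreover have "R x k" if "x \<in> \<Inter>F" "R x g" for x
      using h k that \<open>P \<in> F\<close> by (auto simp: is_greatest_def)
    ultimately have "k = h"
      using min[of k] factor kP by blast
    with kP show ?thesis by simp
  qed
  then have "is_greatest R {x \<in> \<Inter>F. R x g} h"
    using h by (auto simp: is_greatest_def)
  then show ?thesis ..
qed

lemma parabolic_Inter:
  assumes sp: "\<And>P. P \<in> F \<Longrightarrow> standard_parabolic M P" and ne: "F \<noteq> {}"
  shows "standard_parabolic M (\<Inter>F)"
proof -
  have F: "P \<subseteq> carrier M" if "P \<in> F" for P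
    using parabolic_carrier[OF sp[OF that]] by (rule subsetI)
  have "submonoid (\<Inter>F) M"
  proof (rule submonoid.intro)
    show "\<Inter>F \<subseteq> carrier M" using F ne by auto
    show "\<one> \<in> \<Inter>F" using parabolic_one[OF sp] by simp
    show "x \<otimes> y \<in> \<Inter>F" if "x \<in> \<Inter>F" "y \<in> \<Inter>F" for x y
      using parabolic_mult[OF sp] that by simp
  qed
  moreover have "\<forall>x\<in>\<Inter>F. \<forall>y\<in>carrier M. is_factor M y x \<longrightarrow> y \<in> \<Inter>F"
    using parabolic_factor[OF sp] by auto
  moreover have "\<exists>h. is_greatest (\<lambda>x y. x divides y) {x \<in> \<Inter>F. x divides g} h"
    if "g \<in> carrier M" for g
  proof (rule greatest_in_Inter[where R = "\<lambda>x y. x divides y"])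
    show "\<exists>h. is_greatest (\<lambda>x y. x divides y) {x \<in> P. x divides g} h"
      if "P \<in> F" "g \<in> carrier M" for P g
      using sp[OF that(1)] that(2) unfolding standard_parabolic_def by blast
    show "x divides z" if "x divides y" "y divides z" "x \<in> carrier M" for x y z
      using that by (rule divides_trans)
  qed (simp_all add: that F ne divides_is_factor)
  moreover have "\<exists>h. is_greatest (right_divides M) {x \<in> \<Inter>F. right_divides M x g} h"
    if "g \<in> carrier M" for g
  proof (rule greatest_in_Inter[where R = "right_divides M"])
    show "\<exists>h. is_greatest (right_divides M) {x \<in> P. right_divides M x g} h"
      if "P \<in> F" "g \<in> carrier M" for P g
      using sp[OF that(1)] that(2) unfolding standard_parabolic_def by blast
    show "right_divides M x z" if "right_divides M x y" "right_divides M y z" "x \<in> carrier M" for x y z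
      using that by (rule right_divides_trans)
  qed (simp_all add: that F ne right_divides_refl right_divides_is_factor)
  ultimately show ?thesis
    unfolding standard_parabolic_def by blast
qed

lemma parabolic_hull:
  assumes "X \<subseteq> carrier M"
  shows "standard_parabolic M (standard_parabolic M hull X)"
  unfolding hull_def using assms parabolic_whole by (intro parabolic_Inter) blast+

text \<open>
  The image of \<open>P\<close> is standard parabolic relative to \<open>P1\<close> because \<open>\<phi>\<close> preserves divisibility inside
  \<open>P1\<close>; it is standard parabolic in \<open>M\<close> because a head in \<open>P1\<close> can be taken before a head in the image.
\<close>

lemma parabolic_automorphic_image:
  assumes P1: "standard_parabolic M P1" and P: "standard_parabolic M P" "P \<subseteq> P1"
    and bij: "bij_betw \<phi> P1 P1"
    and mult: "\<And>x y. x \<in> P1 \<Longrightarrow> y \<in> P1 \<Longrightarrow> \<phi> (x \<otimes> y) = \<phi> x \<otimes> \<phi> y"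
  shows "standard_parabolic M (\<phi> ` P)"
    and "\<And>g. g \<in> P1 \<Longrightarrow> head M (\<phi> ` P) (\<phi> g) = \<phi> (head M P g)"
proof -
  note carr1 = parabolic_carrier[OF P1]
  have surj: "\<exists>x\<in>P1. y = \<phi> x" if "y \<in> P1" for y
    using bij that by (auto simp: bij_betw_def image_iff)
  have mem: "\<phi> x \<in> P1" if "x \<in> P1" for x
    using bij that by (auto simp: bij_betw_def)
  have inj: "\<phi> x = \<phi> y \<longleftrightarrow> x = y" if "x \<in> P1" "y \<in> P1" for x y
    using bij that by (auto simp: bij_betw_def inj_on_def)
  have one: "\<phi> \<one> = \<one>"
    using mult[of \<one> \<one>] parabolic_one[OF P1] mem carr1 mult_eq_left_iff[of "\<phi> \<one>" "\<phi> \<one>"] by simp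
  have mem_iff: "\<phi> x \<in> \<phi> ` P \<longleftrightarrow> x \<in> P" if "x \<in> P1" for x
    using inj that P(2) by blast
  have ldiv: "\<phi> x divides \<phi> y \<longleftrightarrow> x divides y" if xy: "x \<in> P1" "y \<in> P1" for x y
  proof
    assume "x divides y"
    then obtain c where c: "c \<in> carrier M" "y = x \<otimes> c" by blast
    then have "c \<in> P1" using xy carr1 parabolic_mult_iff[OF P1, of x c] by simp
    then have "\<phi> y = \<phi> x \<otimes> \<phi> c" "\<phi> c \<in> carrier M" using c xy mult mem carr1 by auto
    then show "\<phi> x divides \<phi> y" by blast
  next
    assume "\<phi> x divides \<phi> y"
    then obtain c where c: "c \<in> carrier M" "\<phi> y = \<phi> x \<otimes> c" by blast
    then have "c \<in> P1" using xy mem carr1 parabolic_mult_iff[OF P1, of "\<phi> x" c] by metis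
    then obtain c' where c': "c' \<in> P1" "c = \<phi> c'" using surj by blast
    then have "y = x \<otimes> c'" using c xy mult inj parabolic_mult[OF P1] by metis
    then show "x divides y" using c' carr1 by blast
  qed
  have rdiv: "right_divides M (\<phi> x) (\<phi> y) \<longleftrightarrow> right_divides M x y" if xy: "x \<in> P1" "y \<in> P1" for x y
  proof
    assume "right_divides M x y"
    then obtain c where c: "c \<in> carrier M" "y = c \<otimes> x" unfolding right_divides_def by blast
    then have "c \<in> P1" using xy carr1 parabolic_mult_iff[OF P1, of c x] by simp
    then have "\<phi> y = \<phi> c \<otimes> \<phi> x" "\<phi> c \<in> carrier M" using c xy mult mem carr1 by auto
    then show "right_divides M (\<phi> x) (\<phi> y)" unfolding right_divides_def by blast
  next
    assume "right_divides M (\<phi> x) (\<phi> y)"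
    then obtain c where c: "c \<in> carrier M" "\<phi> y = c \<otimes> \<phi> x" unfolding right_divides_def by blast
    then have "c \<in> P1" using xy mem carr1 parabolic_mult_iff[OF P1, of c "\<phi> x"] by metis
    then obtain c' where c': "c' \<in> P1" "c = \<phi> c'" using surj by blast
    then have "y = c' \<otimes> x" using c xy mult inj parabolic_mult[OF P1] by metis
    then show "right_divides M x y" using c' carr1 unfolding right_divides_def by blast
  qed
  \<comment> \<open>A greatest divisor in \<open>P1\<close> is computed first, so that \<open>\<phi>\<close> can be applied.\<close>
  have greatest_transfer: "\<exists>h. is_greatest R {x \<in> \<phi> ` P. R x g} h"
    if R: "\<And>x y. x \<in> P1 \<Longrightarrow> y \<in> P1 \<Longrightarrow> R (\<phi> x) (\<phi> y) \<longleftrightarrow> R x y"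
    and tr: "\<And>x y z. R x y \<Longrightarrow> R y z \<Longrightarrow> x \<in> carrier M \<Longrightarrow> R x z"
    and ex1: "\<And>g. g \<in> carrier M \<Longrightarrow> \<exists>h. is_greatest R {x \<in> P1. R x g} h"
    and ex: "\<And>g. g \<in> carrier M \<Longrightarrow> \<exists>h. is_greatest R {x \<in> P. R x g} h"
    and g: "g \<in> carrier M" for R g
  proof -
    obtain h1 where h1: "is_greatest R {x \<in> P1. R x g} h1" using ex1[OF g] ..
    then obtain h1' where h1': "h1' \<in> P1" "h1 = \<phi> h1'" using surj by (auto simp: is_greatest_def)
    obtain k where k: "is_greatest R {x \<in> P. R x h1'} k" using ex[OF carr1[OF h1'(1)]] ..
    then have kP: "k \<in> P" "R k h1'" by (auto simp: is_greatest_def)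
    then have "R (\<phi> k) h1" using R h1' P(2) by blast
    then have "R (\<phi> k) g" using tr h1 kP(1) P(2) mem carr1 unfolding is_greatest_def by blast
    moreover have "R (\<phi> x) (\<phi> k)" if "x \<in> P" "R (\<phi> x) g" for x
    proof -
      have "\<phi> x \<in> P1" using that P(2) mem by blast
      then have "R (\<phi> x) (\<phi> h1')" using h1 h1' that by (auto simp: is_greatest_def)
      then have "R x h1'" using R that P(2) h1' by blast
      then have "R x k" using k that by (auto simp: is_greatest_def)
      then show ?thesis using R that P(2) kP by blast
    qed
    ultimately have "is_greatest R {x \<in> \<phi> ` P. R x g} (\<phi> k)"
      using kP by (auto simp: is_greatest_def)
    then show ?thesis ..
  qed
  show "standard_parabolic M (\<phi> ` P)"
    unfolding standard_parabolic_def
  proof (intro conjI ballI impI)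
    show "submonoid (\<phi> ` P) M"
    proof (rule submonoid.intro)
      show "\<phi> ` P \<subseteq> carrier M" using P(2) mem carr1 by blast
      show "\<one> \<in> \<phi> ` P" using one parabolic_one[OF P(1)] by force
      fix x y assume "x \<in> \<phi> ` P" "y \<in> \<phi> ` P"
      then obtain x' y' where *: "x' \<in> P" "x = \<phi> x'" "y' \<in> P" "y = \<phi> y'" by blast
      then have "x \<otimes> y = \<phi> (x' \<otimes> y')" using mult P(2) by (simp add: subset_iff)
      then show "x \<otimes> y \<in> \<phi> ` P" using * parabolic_mult[OF P(1)] by blast
    qed
  next
    fix x y assume x: "x \<in> \<phi> ` P" and y: "y \<in> carrier M" and f: "is_factor M y x"
    obtain x' where x': "x' \<in> P" "x = \<phi> x'" using x by blast
    obtain u v where uv: "u \<in> carrier M" "v \<in> carrier M" "x = u \<otimes> (y \<otimes> v)"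
      using f by (rule is_factorE)
    have "x \<in> P1" using x' P(2) mem by blast
    then have "u \<in> P1" "y \<in> P1" "v \<in> P1"
      using uv y parabolic_mult_iff[OF P1] by auto
    then obtain u' y' v' where p: "u' \<in> P1" "u = \<phi> u'" "y' \<in> P1" "y = \<phi> y'" "v' \<in> P1" "v = \<phi> v'"
      using surj by meson
    then have "\<phi> x' = \<phi> (u' \<otimes> (y' \<otimes> v'))"
      using uv x' mult parabolic_mult[OF P1] by simp
    then have "x' = u' \<otimes> (y' \<otimes> v')"
      using inj[of x' "u' \<otimes> (y' \<otimes> v')"] x' P(2) p parabolic_mult[OF P1] by blast
    then have "y' \<in> P"
      using x'(1) p carr1 parabolic_mult_iff[OF P(1)] by simp
    then show "y \<in> \<phi> ` P" using p by blast
  next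
    fix g assume g: "g \<in> carrier M"
    show "\<exists>h. is_greatest (\<lambda>x y. x divides y) {x \<in> \<phi> ` P. x divides g} h"
    proof (rule greatest_transfer[of "\<lambda>x y. x divides y"])
      show "x divides z" if "x divides y" "y divides z" "x \<in> carrier M" for x y z
        using that by (rule divides_trans)
    qed (use P1 P(1) g ldiv in \<open>simp_all add: standard_parabolic_def\<close>)
    show "\<exists>h. is_greatest (right_divides M) {x \<in> \<phi> ` P. right_divides M x g} h"
    proof (rule greatest_transfer[of "right_divides M"])
      show "right_divides M x z" if "right_divides M x y" "right_divides M y z" "x \<in> carrier M" for x y z
        using that by (rule right_divides_trans)
    qed (use P1 P(1) g rdiv in \<open>simp_all add: standard_parabolic_def\<close>)
  qed
  fix g assume g: "g \<in> P1"
  show "head M (\<phi> ` P) (\<phi> g) = \<phi> (head M P g)"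
  proof (rule head_eqI)
    show "\<phi> ` P \<subseteq> carrier M" using P(2) mem carr1 by blast
    have h: "head M P g \<in> P" using head_mem[OF P(1) carr1[OF g]] .
    then show "\<phi> (head M P g) \<in> \<phi> ` P" by blast
    show "\<phi> (head M P g) divides \<phi> g"
      using ldiv[of "head M P g" g] h P(2) g head_divides[OF P(1) carr1[OF g]] by blast
    fix x assume "x \<in> \<phi> ` P" "x divides \<phi> g"
    then obtain x' where x': "x' \<in> P" "x = \<phi> x'" "\<phi> x' divides \<phi> g" by blast
    then have "x' divides g" using ldiv[of x' g] P(2) g by blast
    then have "x' divides head M P g" using head_greatest[OF P(1) carr1[OF g] x'(1)] by blast
    then show "x divides \<phi> (head M P g)"
      using ldiv[of x' "head M P g"] x' P(2) h by blast
  qed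
qed

lemma Delta_carrier: "\<Delta> \<in> carrier M"
  using garside by (simp add: garside_element_def)

lemma Delta_balanced: "x \<in> carrier M \<Longrightarrow> x divides \<Delta> \<longleftrightarrow> right_divides M x \<Delta>"
  using garside unfolding garside_element_def by blast

text \<open>
  The greatest right-divisor \<open>k\<close> of \<open>\<Delta>\<close> in \<open>P\<close> equals \<open>\<Delta>\<^sub>P\<close>: each is a factor of the other, since left-
  and right-divisors of \<open>\<Delta>\<close> coincide. So the elements of \<open>P\<close> dividing \<open>\<Delta>\<^sub>P\<close> on either side are
  precisely those dividing \<open>\<Delta>\<close>.
\<close>

lemma head_Delta_balanced:
  assumes P: "standard_parabolic M P" and x: "x \<in> P"
  shows "x divides head M P \<Delta> \<longleftrightarrow> right_divides M x (head M P \<Delta>)"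
proof -
  let ?d = "head M P \<Delta>"
  note carr = parabolic_carrier[OF P]
  note d = head_mem[OF P Delta_carrier] head_divides[OF P Delta_carrier]
  obtain k where k: "is_greatest (right_divides M) {x \<in> P. right_divides M x \<Delta>} k"
    using P Delta_carrier unfolding standard_parabolic_def by blast
  then have kP: "k \<in> P" "right_divides M k \<Delta>"
    and kmax: "\<And>y. y \<in> P \<Longrightarrow> right_divides M y \<Delta> \<Longrightarrow> right_divides M y k"
    by (auto simp: is_greatest_def)
  have "right_divides M ?d k"
    using d carr Delta_balanced kmax by blast
  moreover have "k divides ?d"
    using kP carr Delta_balanced head_greatest[OF P Delta_carrier] by blast
  ultimately have "k = ?d"
    using carr[OF kP(1)] carr[OF d(1)]
    by (intro is_factor_antisym divides_is_factor right_divides_is_factor)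
  show ?thesis
  proof
    assume "x divides ?d"
    then have "x divides \<Delta>" using divides_trans[OF _ d(2) carr[OF x]] by blast
    then have "right_divides M x k" using Delta_balanced carr x kmax by blast
    then show "right_divides M x ?d" using \<open>k = ?d\<close> by simp
  next
    assume "right_divides M x ?d"
    then have "right_divides M x \<Delta>"
      using right_divides_trans[OF _ _ carr[OF x]] kP(2) \<open>k = ?d\<close> by blast
    then have "x divides \<Delta>" using Delta_balanced carr x by blast
    then show "x divides ?d" using head_greatest[OF P Delta_carrier x] by blast
  qed
qed

end

section \<open>The Garside element of a standard parabolic submonoid\<close>

text \<open>
  The first condition is what ties \<open>\<Delta>\<close> to the atoms: applied to a single atom it shows that every atom
  divides \<open>\<Delta>\<close>, and applied to the atoms of \<open>P\<close> and one more it produces ribbons. The second supplies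
  the exponents of the elements \<open>z\<^sub>P\<close>.
\<close>

locale lcm_garside_monoid = garside_monoid +
  assumes right_lcm_atoms:
    "\<And>X. X \<subseteq> atoms M \<Longrightarrow> is_right_lcm_set M X (head M (standard_parabolic M hull X) \<Delta>)"
    and central_power: "\<And>P. standard_parabolic M P \<Longrightarrow>
      \<exists>n::nat. 0 < n \<and> centralizes M P (head M P \<Delta> [^] n)"
begin

lemma atom_divides_head_Delta:
  assumes P: "standard_parabolic M P" and a: "a \<in> atoms M" "a \<in> P"
  shows "a divides head M P \<Delta>"
proof -
  let ?H = "standard_parabolic M hull {a}"
  have H: "standard_parabolic M ?H"
    using atomsD[OF a(1)] by (intro parabolic_hull) simp
  have "a divides head M ?H \<Delta>"
    using right_lcm_atoms[of "{a}"] a(1) by (simp add: is_right_lcm_set_def is_least_def)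
  then have "a divides \<Delta>"
    using divides_trans[OF _ head_divides[OF H Delta_carrier]] atomsD[OF a(1)] by blast
  then show ?thesis
    using head_greatest[OF P Delta_carrier a(2)] by blast
qed

text \<open>
  For an atom \<open>a\<close> of \<open>P\<close>, taking complements twice gives \<open>\<Delta>\<^sub>P = a c = c a'\<close>, whence \<open>a \<Delta>\<^sub>P = \<Delta>\<^sub>P a'\<close>;
  products of atoms follow. The next lemma is the mirror image.
\<close>

lemma head_Delta_conj_right:
  assumes P: "standard_parabolic M P" and x: "x \<in> P"
  shows "\<exists>y\<in>P. x \<otimes> head M P \<Delta> = head M P \<Delta> \<otimes> y"
  using P x
proof (induction x rule: parabolic_induct)
  case one
  have "\<one> \<otimes> head M P \<Delta> = head M P \<Delta> \<otimes> \<one>"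
    using parabolic_carrier[OF P head_mem[OF P Delta_carrier]] by simp
  then show ?case using parabolic_one[OF P] by blast
next
  case (mult a y)
  let ?d = "head M P \<Delta>"
  note carr = parabolic_carrier[OF P]
  have d: "?d \<in> P" by (rule head_mem[OF P Delta_carrier])
  obtain c where c: "c \<in> carrier M" "?d = a \<otimes> c"
    using atom_divides_head_Delta[OF P mult.hyps(1,2)] by blast
  then have cP: "c \<in> P" using d carr[OF mult.hyps(2)] parabolic_mult_iff[OF P, of a c] by simp
  have "right_divides M c ?d"
    using c carr[OF mult.hyps(2)] unfolding right_divides_def by blast
  then have "c divides ?d"
    using head_Delta_balanced[OF P cP] by simp
  then obtain a' where a': "a' \<in> carrier M" "?d = c \<otimes> a'"
    by blast
  then have a'P: "a' \<in> P" using d c parabolic_mult_iff[OF P, of c a'] by simp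
  obtain y' where y': "y' \<in> P" "y \<otimes> ?d = ?d \<otimes> y'" using mult.IH by blast
  have a: "a \<in> carrier M" "y \<in> carrier M" "y' \<in> carrier M"
    using carr mult.hyps y' by auto
  have "a \<otimes> ?d = ?d \<otimes> a'"
    using c a' a by (metis m_assoc)
  then have "a \<otimes> y \<otimes> ?d = ?d \<otimes> (a' \<otimes> y')"
    using a a' y' carr[OF d] by (metis m_assoc)
  then show ?case
    using parabolic_mult[OF P a'P y'(1)] by blast
qed

lemma head_Delta_conj_left:
  assumes P: "standard_parabolic M P" and x: "x \<in> P"
  shows "\<exists>y\<in>P. y \<otimes> head M P \<Delta> = head M P \<Delta> \<otimes> x"
  using P x
proof (induction x rule: parabolic_induct)
  case one
  have "\<one> \<otimes> head M P \<Delta> = head M P \<Delta> \<otimes> \<one>"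
    using parabolic_carrier[OF P head_mem[OF P Delta_carrier]] by simp
  then show ?case using parabolic_one[OF P] by blast
next
  case (mult a y)
  let ?d = "head M P \<Delta>"
  note carr = parabolic_carrier[OF P]
  have d: "?d \<in> P" by (rule head_mem[OF P Delta_carrier])
  have "right_divides M a ?d"
    using atom_divides_head_Delta[OF P mult.hyps(1,2)] head_Delta_balanced[OF P mult.hyps(2)] by simp
  then obtain c where c: "c \<in> carrier M" "?d = c \<otimes> a"
    unfolding right_divides_def by blast
  then have cP: "c \<in> P" using d carr[OF mult.hyps(2)] parabolic_mult_iff[OF P, of c a] by simp
  have "c divides ?d"
    using c carr[OF mult.hyps(2)] by blast
  then have "right_divides M c ?d"
    using head_Delta_balanced[OF P cP] by simp
  then obtain a' where a': "a' \<in> carrier M" "?d = a' \<otimes> c"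
    unfolding right_divides_def by blast
  then have a'P: "a' \<in> P" using d c parabolic_mult_iff[OF P, of a' c] by simp
  obtain y' where y': "y' \<in> P" "y' \<otimes> ?d = ?d \<otimes> y" using mult.IH by blast
  have a: "a \<in> carrier M" "y \<in> carrier M" "y' \<in> carrier M"
    using carr mult.hyps y' by auto
  have "a' \<otimes> ?d = ?d \<otimes> a"
    using c a' a by (metis m_assoc)
  then have "(a' \<otimes> y') \<otimes> ?d = ?d \<otimes> (a \<otimes> y)"
    using a a' y' carr[OF d] by (metis m_assoc)
  then show ?case
    using parabolic_mult[OF P a'P y'(1)] by blast
qed

text \<open>
  Conjugation by \<open>\<Delta>\<^sub>P\<close>, written without inverses so that it makes sense inside the monoid.
\<close>

lemma head_Delta_automorphism:
  assumes P: "standard_parabolic M P"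
  shows "\<exists>\<phi>. (\<forall>x\<in>P. x \<otimes> head M P \<Delta> = head M P \<Delta> \<otimes> \<phi> x) \<and> bij_betw \<phi> P P \<and>
    (\<forall>x\<in>P. \<forall>y\<in>P. \<phi> (x \<otimes> y) = \<phi> x \<otimes> \<phi> y) \<and> \<phi> (head M P \<Delta>) = head M P \<Delta>"
proof -
  let ?d = "head M P \<Delta>"
  note carr = parabolic_carrier[OF P]
  have d: "?d \<in> P" "?d \<in> carrier M" using head_mem[OF P Delta_carrier] carr by auto
  have "\<forall>x\<in>P. \<exists>y. y \<in> P \<and> x \<otimes> ?d = ?d \<otimes> y"
    using head_Delta_conj_right[OF P] by blast
  then obtain \<phi> where \<phi>: "\<And>x. x \<in> P \<Longrightarrow> \<phi> x \<in> P" "\<And>x. x \<in> P \<Longrightarrow> x \<otimes> ?d = ?d \<otimes> \<phi> x"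
    using bchoice[of P "\<lambda>x y. y \<in> P \<and> x \<otimes> ?d = ?d \<otimes> y"] by blast
  have unique: "\<phi> x = y" if "x \<in> P" "y \<in> P" "x \<otimes> ?d = ?d \<otimes> y" for x y
    using l_cancel[of ?d "\<phi> x" y] \<phi>[OF that(1)] that carr d by simp
  have "inj_on \<phi> P"
  proof (rule inj_onI)
    fix x y assume "x \<in> P" "y \<in> P" "\<phi> x = \<phi> y"
    then show "x = y" using r_cancel[of x ?d y] \<phi>(2) carr d by simp
  qed
  moreover have "\<phi> ` P = P"
  proof
    show "\<phi> ` P \<subseteq> P" using \<phi>(1) by blast
    show "P \<subseteq> \<phi> ` P"
    proof
      fix y assume "y \<in> P"
      then obtain x where x: "x \<in> P" "x \<otimes> ?d = ?d \<otimes> y" using head_Delta_conj_left[OF P] by blast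
      with \<open>y \<in> P\<close> have "y = \<phi> x" using unique by simp
      with x show "y \<in> \<phi> ` P" by blast
    qed
  qed
  moreover have "\<phi> (x \<otimes> y) = \<phi> x \<otimes> \<phi> y" if xy: "x \<in> P" "y \<in> P" for x y
  proof (rule unique)
    have c: "x \<in> carrier M" "y \<in> carrier M" "\<phi> x \<in> carrier M" "\<phi> y \<in> carrier M"
      using xy \<phi>(1) carr by auto
    show "x \<otimes> y \<otimes> ?d = ?d \<otimes> (\<phi> x \<otimes> \<phi> y)"
      using \<phi>(2)[OF xy(1)] \<phi>(2)[OF xy(2)] c d(2) by (metis m_assoc)
  qed (use xy \<phi>(1) parabolic_mult[OF P] in auto)
  moreover have "\<phi> ?d = ?d"
    by (rule unique) (use d in auto)
  ultimately show ?thesis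
    using \<phi>(2) unfolding bij_betw_def by (intro exI[of _ \<phi>]) simp
qed

end

section \<open>Conjugation by ribbons\<close>

context garside_monoid
begin

lemma ribbonD:
  assumes "ribbon M P r"
  shows "r \<in> carrier M" "reduced M P r" "\<And>p. p \<in> P \<Longrightarrow> \<exists>q\<in>carrier M. p \<otimes> r = r \<otimes> q"
  using assms reduced_carrier unfolding ribbon_def factor_def by blast+

text \<open>
  This is \<open>P\<^sup>r\<close>, described without the group of fractions. For a ribbon \<open>r\<close> it is the image of \<open>P\<close> under
  conjugation by \<open>r\<close> (\<open>conj_by_ribbon_image\<close>).
\<close>

definition conjugate_set :: "'a set \<Rightarrow> 'a \<Rightarrow> 'a set" where
  "conjugate_set P r = {q \<in> carrier M. \<exists>p\<in>P. p \<otimes> r = r \<otimes> q}"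

lemma conjugate_set_one: "P \<subseteq> carrier M \<Longrightarrow> conjugate_set P \<one> = P"
  unfolding conjugate_set_def by force

lemma conjugate_set_memE:
  assumes "q \<in> conjugate_set P r"
  obtains p where "p \<in> P" "q \<in> carrier M" "p \<otimes> r = r \<otimes> q"
  using assms unfolding conjugate_set_def by blast

lemma conjugate_set_memI:
  assumes "p \<in> P" "q \<in> carrier M" "p \<otimes> r = r \<otimes> q"
  shows "q \<in> conjugate_set P r"
  using assms unfolding conjugate_set_def by blast

lemma conjugate_commute:
  assumes "p \<otimes> d = d \<otimes> q" "q \<otimes> r = r \<otimes> q'"
    and "p \<in> carrier M" "q \<in> carrier M" "q' \<in> carrier M" "d \<in> carrier M" "r \<in> carrier M"
  shows "p \<otimes> (d \<otimes> r) = (d \<otimes> r) \<otimes> q'"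
  using assms by (metis m_assoc)

lemma conjugate_set_mult:
  assumes P: "standard_parabolic M P" and d: "ribbon M P d" and r: "r \<in> carrier M"
  shows "conjugate_set (conjugate_set P d) r = conjugate_set P (d \<otimes> r)"
proof
  note dc = ribbonD(1)[OF d] and carr = parabolic_carrier[OF P]
  show "conjugate_set (conjugate_set P d) r \<subseteq> conjugate_set P (d \<otimes> r)"
  proof
    fix x assume "x \<in> conjugate_set (conjugate_set P d) r"
    then obtain q where q: "q \<in> conjugate_set P d" "x \<in> carrier M" "q \<otimes> r = r \<otimes> x"
      by (rule conjugate_set_memE)
    obtain p where p: "p \<in> P" "q \<in> carrier M" "p \<otimes> d = d \<otimes> q"
      using q(1) by (rule conjugate_set_memE)
    show "x \<in> conjugate_set P (d \<otimes> r)"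
      using conjugate_commute[OF p(3) q(3)] p q r dc carr by (intro conjugate_set_memI[of p]) auto
  qed
  show "conjugate_set P (d \<otimes> r) \<subseteq> conjugate_set (conjugate_set P d) r"
  proof
    fix x assume "x \<in> conjugate_set P (d \<otimes> r)"
    then obtain p where p: "p \<in> P" "x \<in> carrier M" "p \<otimes> (d \<otimes> r) = d \<otimes> r \<otimes> x"
      by (rule conjugate_set_memE)
    obtain q where q: "q \<in> carrier M" "p \<otimes> d = d \<otimes> q" using ribbonD(3)[OF d p(1)] by blast
    have "d \<otimes> (q \<otimes> r) = d \<otimes> (r \<otimes> x)"
      using p q r dc carr[OF p(1)] by (metis m_assoc)
    then have "q \<otimes> r = r \<otimes> x" using l_cancel[of d] q r p dc by simp
    with conjugate_set_memI[OF p(1) q] p(2) show "x \<in> conjugate_set (conjugate_set P d) r"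
      by (rule conjugate_set_memI)
  qed
qed

text \<open>
  Let \<open>p \<in> P\<close> and \<open>q \<in> P\<^sup>d\<close> correspond, that is \<open>p d = d q\<close>. If \<open>q\<close> divides \<open>r\<close>, then \<open>p\<close> divides
  \<open>d r\<close>; and \<open>r\<close> divides \<open>q r\<close> exactly when \<open>d r\<close> divides \<open>p d r\<close>.
\<close>

lemma ribbon_mult_iff:
  assumes P: "standard_parabolic M P" and d: "ribbon M P d"
    and Q: "standard_parabolic M (conjugate_set P d)" and r: "r \<in> carrier M"
  shows "reduced M P (d \<otimes> r) \<Longrightarrow> reduced M (conjugate_set P d) r"
    and "reduced M P (d \<otimes> r) \<Longrightarrow>
      ribbon M P (d \<otimes> r) \<longleftrightarrow> ribbon M (conjugate_set P d) r"
proof -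
  note dc = ribbonD(1)[OF d] and carr = parabolic_carrier[OF P]
  assume red: "reduced M P (d \<otimes> r)"
  show red': "reduced M (conjugate_set P d) r"
  proof (rule reducedI[OF Q r])
    fix q assume "q \<in> conjugate_set P d" "q divides r"
    then obtain p where p: "p \<in> P" "q \<in> carrier M" "p \<otimes> d = d \<otimes> q"
      by (auto elim: conjugate_set_memE)
    have "p divides (d \<otimes> q)" using p dc carr by (auto simp flip: p(3))
    moreover have "(d \<otimes> q) divides (d \<otimes> r)" using \<open>q divides r\<close> p dc r by simp
    ultimately have "p divides (d \<otimes> r)" using divides_trans carr p by blast
    then have "p = \<one>" using reducedD[OF P red p(1)] by simp
    then show "q = \<one>" using p dc mult_eq_left_iff[of d q] by simp
  qed
  show "ribbon M P (d \<otimes> r) \<longleftrightarrow> ribbon M (conjugate_set P d) r"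
  proof
    assume "ribbon M P (d \<otimes> r)"
    have "r divides (q \<otimes> r)" if q: "q \<in> conjugate_set P d" for q
    proof -
      obtain p where p: "p \<in> P" "q \<in> carrier M" "p \<otimes> d = d \<otimes> q"
        using q by (rule conjugate_set_memE)
      obtain x where x: "x \<in> carrier M" "p \<otimes> (d \<otimes> r) = d \<otimes> r \<otimes> x"
        using ribbonD(3)[OF \<open>ribbon M P (d \<otimes> r)\<close> p(1)] by blast
      have "d \<otimes> (q \<otimes> r) = d \<otimes> (r \<otimes> x)"
        using p x r dc carr[OF p(1)] by (metis m_assoc)
      then have "q \<otimes> r = r \<otimes> x" using l_cancel[of d] p r x dc by simp
      then show ?thesis using x by blast
    qed
    with red' show "ribbon M (conjugate_set P d) r" by (simp add: ribbon_def)
  next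
    assume rib: "ribbon M (conjugate_set P d) r"
    have "d \<otimes> r divides (p \<otimes> (d \<otimes> r))" if p: "p \<in> P" for p
    proof -
      obtain q where q: "q \<in> carrier M" "p \<otimes> d = d \<otimes> q" using ribbonD(3)[OF d p] by blast
      then obtain x where x: "x \<in> carrier M" "q \<otimes> r = r \<otimes> x"
        using ribbonD(3)[OF rib conjugate_set_memI[OF p q]] by blast
      show ?thesis
        using conjugate_commute[OF q(2) x(2)] q x p r dc carr by blast
    qed
    with red show "ribbon M P (d \<otimes> r)" by (simp add: ribbon_def)
  qed
qed

end

context lcm_garside_monoid
begin

text \<open>
  The witness is \<open>d\<close> with \<open>\<Delta>\<^sub>P d\<close> the Garside element of the smallest standard parabolic submonoid containing
  \<open>P\<close> and an atom \<open>s\<close> dividing \<open>u\<close>. The last property is the engine of all later arguments: it holds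
  because \<open>\<Delta>\<^sub>P d\<close> is the right-lcm of \<open>s\<close> and the atoms of \<open>P\<close>, all of which divide \<open>\<Delta>\<^sub>P x\<close>.
\<close>

lemma elementary_ribbon:
  assumes P: "standard_parabolic M P" and u: "reduced M P u" "u \<noteq> \<one>"
  obtains d where "ribbon M P d" "d \<noteq> \<one>" "standard_parabolic M (conjugate_set P d)"
    and "head M P \<Delta> \<otimes> d = d \<otimes> head M (conjugate_set P d) \<Delta>"
    and "\<And>x. x \<in> carrier M \<Longrightarrow> u divides (head M P \<Delta> \<otimes> x) \<Longrightarrow> d divides x"
proof -
  note carr = parabolic_carrier[OF P]
  let ?dP = "head M P \<Delta>"
  have dP: "?dP \<in> P" "?dP \<in> carrier M" using head_mem[OF P Delta_carrier] carr by auto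
  obtain s where s: "s \<in> atoms M" "s divides u"
    using atom_divides u reduced_carrier by blast
  have sc: "s \<in> carrier M" "s \<noteq> \<one>" using atomsD[OF s(1)] by auto
  have "s \<notin> P" using reducedD[OF P u(1) _ s(2)] sc by blast
  define X where "X = insert s (atoms M \<inter> P)"
  define P1 where "P1 = standard_parabolic M hull X"
  have X: "X \<subseteq> atoms M" "X \<subseteq> carrier M" using s atomsD by (auto simp: X_def)
  have P1: "standard_parabolic M P1" unfolding P1_def using X by (intro parabolic_hull)
  note carr1 = parabolic_carrier[OF P1]
  have XP1: "X \<subseteq> P1" unfolding P1_def by (rule hull_subset)
  have sub: "P \<subseteq> P1"
  proof
    fix x assume "x \<in> P"
    with P show "x \<in> P1"
    proof (induction x rule: parabolic_induct)
      case one show ?case by (rule parabolic_one[OF P1])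
    next
      case (mult a y)
      then show ?case using XP1 by (intro parabolic_mult[OF P1]) (auto simp: X_def)
    qed
  qed
  let ?d1 = "head M P1 \<Delta>"
  have d1: "?d1 \<in> P1" "?d1 \<in> carrier M" using head_mem[OF P1 Delta_carrier] carr1 by auto
  have lcm: "?d1 divides x" if "x \<in> carrier M" "\<And>y. y \<in> X \<Longrightarrow> y divides x" for x
    using right_lcm_atoms[OF X(1)] that by (auto simp: P1_def is_right_lcm_set_def is_least_def)
  have s_d1: "s divides ?d1"
    using atom_divides_head_Delta[OF P1 s(1)] XP1 by (auto simp: X_def)
  have "?dP divides ?d1"
    using head_greatest[OF P1 Delta_carrier] dP sub head_divides[OF P Delta_carrier] by blast
  then obtain d where d: "d \<in> carrier M" "?d1 = ?dP \<otimes> d" by blast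
  have "d \<noteq> \<one>"
  proof
    assume "d = \<one>"
    then have "s divides ?dP" using d s_d1 dP by simp
    then have "s \<in> P" using parabolic_factor[OF P dP(1) sc(1)] divides_is_factor sc by blast
    with \<open>s \<notin> P\<close> show False by blast
  qed
  obtain \<phi> where "\<forall>x\<in>P1. x \<otimes> ?d1 = ?d1 \<otimes> \<phi> x" "bij_betw \<phi> P1 P1"
    "\<forall>x\<in>P1. \<forall>y\<in>P1. \<phi> (x \<otimes> y) = \<phi> x \<otimes> \<phi> y" "\<phi> ?d1 = ?d1"
    using head_Delta_automorphism[OF P1] by blast
  then have \<phi>: "\<And>x. x \<in> P1 \<Longrightarrow> x \<otimes> ?d1 = ?d1 \<otimes> \<phi> x" "bij_betw \<phi> P1 P1"
    "\<And>x y. x \<in> P1 \<Longrightarrow> y \<in> P1 \<Longrightarrow> \<phi> (x \<otimes> y) = \<phi> x \<otimes> \<phi> y" "\<phi> ?d1 = ?d1"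
    by auto
  have \<phi>P1: "\<phi> x \<in> P1" if "x \<in> P1" for x using \<phi>(2) that by (auto simp: bij_betw_def)
  \<comment> \<open>Conjugation by \<open>d\<close> on \<open>P\<close> is the inverse of conjugation by \<open>\<Delta>\<^sub>P\<close>, followed by \<open>\<phi>\<close>.\<close>
  have shift: "p \<otimes> d = d \<otimes> \<phi> p0" if p: "p \<in> P" "p0 \<in> P" "p0 \<otimes> ?dP = ?dP \<otimes> p" for p p0
  proof -
    have c: "p \<in> carrier M" "p0 \<in> carrier M" "\<phi> p0 \<in> carrier M"
      using p carr carr1 sub \<phi>P1 by auto
    have "?dP \<otimes> (p \<otimes> d) = p0 \<otimes> ?d1"
      using c d p dP by (metis m_assoc)
    also have "\<dots> = ?dP \<otimes> (d \<otimes> \<phi> p0)"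
      using \<phi>(1)[of p0] p sub c d dP by (auto simp: m_assoc)
    finally show ?thesis using l_cancel[of ?dP] c d dP by simp
  qed
  have Q: "conjugate_set P d = \<phi> ` P"
  proof
    show "conjugate_set P d \<subseteq> \<phi> ` P"
    proof
      fix q assume "q \<in> conjugate_set P d"
      then obtain p where p: "p \<in> P" "q \<in> carrier M" "p \<otimes> d = d \<otimes> q" by (rule conjugate_set_memE)
      obtain p0 where p0: "p0 \<in> P" "p0 \<otimes> ?dP = ?dP \<otimes> p" using head_Delta_conj_left[OF P p(1)] by blast
      have "\<phi> p0 \<in> carrier M" using p0 sub \<phi>P1 carr1 by blast
      then have "q = \<phi> p0" using shift[OF p(1) p0] p d l_cancel[of d q "\<phi> p0"] by simp
      with p0 show "q \<in> \<phi> ` P" by blast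
    qed
    show "\<phi> ` P \<subseteq> conjugate_set P d"
    proof
      fix q assume "q \<in> \<phi> ` P"
      then obtain p0 where p0: "p0 \<in> P" "q = \<phi> p0" by blast
      obtain p where p: "p \<in> P" "p0 \<otimes> ?dP = ?dP \<otimes> p" using head_Delta_conj_right[OF P p0(1)] by blast
      show "q \<in> conjugate_set P d"
        using shift[OF p(1) p0(1) p(2)] p(1) p0 sub \<phi>P1 carr1 by (intro conjugate_set_memI) auto
    qed
  qed
  have Q_parabolic: "standard_parabolic M (\<phi> ` P)"
    by (rule parabolic_automorphic_image(1)[OF P1 P sub \<phi>(2)]) (rule \<phi>(3))
  have "head M (\<phi> ` P) \<Delta> = \<phi> ?dP"
  proof -
    \<comment> \<open>Inside \<open>P1\<close>, the Garside elements can be computed from \<open>?d1\<close>, which \<open>\<phi>\<close> fixes.\<close>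
    have below: "head M P' \<Delta> = head M P' ?d1" if P': "standard_parabolic M P'" "P' \<subseteq> P1" for P'
    proof (rule head_eqI[symmetric])
      show "P' \<subseteq> carrier M" using P'(2) carr1 by blast
      show h: "head M P' \<Delta> \<in> P'" by (rule head_mem[OF P'(1) Delta_carrier])
      show "head M P' \<Delta> divides ?d1"
        using head_greatest[OF P1 Delta_carrier] h P'(2) head_divides[OF P'(1) Delta_carrier] by blast
      fix x assume "x \<in> P'" "x divides ?d1"
      then have "x divides \<Delta>"
        using divides_trans[OF _ head_divides[OF P1 Delta_carrier]] P'(2) carr1 by blast
      then show "x divides head M P' \<Delta>"
        using head_greatest[OF P'(1) Delta_carrier \<open>x \<in> P'\<close>] by blast
    qed
    have "\<phi> ` P \<subseteq> P1" using sub \<phi>P1 by blast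
    then have "head M (\<phi> ` P) \<Delta> = head M (\<phi> ` P) (\<phi> ?d1)"
      using below[OF Q_parabolic] \<phi>(4) by simp
    also have "\<dots> = \<phi> (head M P ?d1)" 
      by (rule parabolic_automorphic_image(2)[OF P1 P sub \<phi>(2) _ d1(1)]) (rule \<phi>(3))
    finally show ?thesis using below[OF P sub] by simp
  qed
  then have conj: "?dP \<otimes> d = d \<otimes> head M (conjugate_set P d) \<Delta>"
    using shift[OF dP(1) dP(1) refl] Q by simp
  have "reduced M P d"
  proof (rule reducedI[OF P d(1)])
    fix p assume p: "p \<in> P" "p divides d"
    have pc: "p \<in> carrier M" using carr p by blast
    \<comment> \<open>\<open>\<Delta>\<^sub>P p\<close> is an element of \<open>P\<close> dividing \<open>\<Delta>\<close>, so it cannot exceed \<open>\<Delta>\<^sub>P\<close>.\<close>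
    have "(?dP \<otimes> p) divides ?d1" using p d dP pc by simp
    then have "(?dP \<otimes> p) divides \<Delta>"
      using divides_trans[OF _ head_divides[OF P1 Delta_carrier]] pc dP by simp
    then have "(?dP \<otimes> p) divides (?dP \<otimes> \<one>)"
      using head_greatest[OF P Delta_carrier] parabolic_mult[OF P dP(1) p(1)] dP by simp
    then have "p divides \<one>" using divides_mult_l[OF pc one_closed dP(2)] by blast
    then show "p = \<one>" using divides_one pc by blast
  qed
  moreover have "d divides (p \<otimes> d)" if p: "p \<in> P" for p
  proof -
    obtain p0 where p0: "p0 \<in> P" "p0 \<otimes> ?dP = ?dP \<otimes> p" using head_Delta_conj_left[OF P p] by blast
    have "\<phi> p0 \<in> carrier M" using p0 sub \<phi>P1 carr1 by blast
    then show ?thesis using shift[OF p p0] by blast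
  qed
  ultimately have "ribbon M P d" by (simp add: ribbon_def)
  moreover have "d divides x" if x: "x \<in> carrier M" "u divides (?dP \<otimes> x)" for x
  proof -
    have "?d1 divides (?dP \<otimes> x)"
    proof (rule lcm)
      fix y assume "y \<in> X"
      then consider "y = s" | "y \<in> atoms M" "y \<in> P" by (auto simp: X_def)
      then show "y divides (?dP \<otimes> x)"
      proof cases
        case 1
        then show ?thesis using divides_trans[OF s(2) x(2) sc(1)] by simp
      next
        case 2
        then show ?thesis
          using atom_divides_head_Delta[OF P] carr dP x by (intro divides_prod_r) auto
      qed
    qed (use x dP in simp)
    then show ?thesis using d x dP by simp
  qed
  ultimately show thesis
    using that[of d] \<open>d \<noteq> \<one>\<close> Q_parabolic Q conj by simp
qed

text \<open>
  A nontrivial ribbon \<open>r\<close> divides \<open>\<Delta>\<^sub>P r\<close>, so the elementary ribbon obtained from \<open>u = r\<close> divides \<open>r\<close>;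
  the remaining factor is a ribbon for the conjugated submonoid and a proper factor of \<open>r\<close>.
\<close>

theorem ribbon_conjugate:
  assumes "standard_parabolic M P" "ribbon M P r"
  shows "standard_parabolic M (conjugate_set P r) \<and>
    head M P \<Delta> \<otimes> r = r \<otimes> head M (conjugate_set P r) \<Delta>"
  using ribbonD(1)[OF assms(2)] assms
proof (induction r arbitrary: P rule: factor_induct)
  case (step r)
  note P = \<open>standard_parabolic M P\<close> and r = \<open>ribbon M P r\<close>
  note carr = parabolic_carrier[OF P]
  let ?dP = "head M P \<Delta>"
  have dP: "?dP \<in> P" "?dP \<in> carrier M" using head_mem[OF P Delta_carrier] carr by auto
  show ?case
  proof (cases "r = \<one>")
    case True
    have "conjugate_set P \<one> = P" using carr by (intro conjugate_set_one) blast
    then show ?thesis using True P dP by simp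
  next
    case False
    obtain d where d: "ribbon M P d" "d \<noteq> \<one>" "standard_parabolic M (conjugate_set P d)"
      "?dP \<otimes> d = d \<otimes> head M (conjugate_set P d) \<Delta>"
      "\<And>x. x \<in> carrier M \<Longrightarrow> r divides (?dP \<otimes> x) \<Longrightarrow> d divides x"
      using elementary_ribbon[OF P ribbonD(2)[OF r] False] by blast
    have "r divides (?dP \<otimes> r)" using r dP by (simp add: ribbon_def)
    then have "d divides r" using d(5) step.hyps by blast
    then obtain r' where r': "r' \<in> carrier M" "r = d \<otimes> r'" by blast
    have dc: "d \<in> carrier M" by (rule ribbonD(1)[OF d(1)])
    let ?Q = "conjugate_set P d"
    have "ribbon M ?Q r'"
      using ribbon_mult_iff(2)[OF P d(1,3) r'(1)] r r'(2) ribbonD(2) by simp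
    moreover have "r' \<noteq> r" using d(2) dc r' mult_eq_right_iff[of d r'] by auto
    ultimately have IH: "standard_parabolic M (conjugate_set ?Q r')"
      "head M ?Q \<Delta> \<otimes> r' = r' \<otimes> head M (conjugate_set ?Q r') \<Delta>"
      using step.IH[of r' ?Q] d(3) r' right_factor[OF dc r'(1)] by auto
    have dQ: "head M ?Q \<Delta> \<in> carrier M" "head M (conjugate_set ?Q r') \<Delta> \<in> carrier M"
      using parabolic_carrier head_mem d(3) IH(1) Delta_carrier by auto
    have "?dP \<otimes> r = r \<otimes> head M (conjugate_set ?Q r') \<Delta>"
      unfolding r'(2) using conjugate_commute[OF d(4) IH(2)] dQ dc r' dP by simp
    then show ?thesis
      using IH(1) conjugate_set_mult[OF P d(1) r'(1)] r'(2) by simp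
  qed
qed

end

section \<open>Least central powers\<close>

context garside_monoid
begin

lemma conjugate_pow:
  assumes "a \<otimes> r = r \<otimes> b" "a \<in> carrier M" "b \<in> carrier M" "r \<in> carrier M"
  shows "a [^] (n::nat) \<otimes> r = r \<otimes> b [^] n"
proof (induction n)
  case (Suc n)
  have "a [^] Suc n \<otimes> r = a [^] n \<otimes> (r \<otimes> b)"
    using assms by (simp add: m_assoc)
  also have "\<dots> = (a [^] n \<otimes> r) \<otimes> b"
    using assms by (simp add: m_assoc)
  finally show ?case
    using assms Suc.IH by (simp add: m_assoc)
qed (use assms in simp)

lemma parabolic_pow:
  assumes "standard_parabolic M P" "x \<in> P"
  shows "x [^] (n::nat) \<in> P"
  by (induction n) (use assms parabolic_one parabolic_mult in auto)

lemma centralizes_conjugate_set_iff: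
  assumes P: "standard_parabolic M P" and r: "ribbon M P r"
    and Q: "conjugate_set P r \<subseteq> carrier M"
    and zw: "z \<otimes> r = r \<otimes> w" "z \<in> carrier M" "w \<in> carrier M"
  shows "centralizes M P z \<longleftrightarrow> centralizes M (conjugate_set P r) w"
proof -
  note carr = parabolic_carrier[OF P] and rc = ribbonD(1)[OF r]
  have *: "z \<otimes> p = p \<otimes> z \<longleftrightarrow> w \<otimes> q = q \<otimes> w"
    if "p \<in> carrier M" "q \<in> carrier M" "p \<otimes> r = r \<otimes> q" for p q
  proof -
    have "(z \<otimes> p) \<otimes> r = r \<otimes> (w \<otimes> q)" "(p \<otimes> z) \<otimes> r = r \<otimes> (q \<otimes> w)"
      using that zw rc by (metis m_assoc)+
    then show ?thesis
      using that zw rc r_cancel[of "z \<otimes> p" r "p \<otimes> z"] l_cancel[of r "w \<otimes> q" "q \<otimes> w"] by auto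
  qed
  show ?thesis
  proof
    assume L: "centralizes M P z"
    show "centralizes M (conjugate_set P r) w"
      unfolding centralizes_def
    proof
      fix q assume "q \<in> conjugate_set P r"
      then obtain p where "p \<in> P" "q \<in> carrier M" "p \<otimes> r = r \<otimes> q" by (rule conjugate_set_memE)
      then show "w \<otimes> q = q \<otimes> w" using L * carr by (auto simp: centralizes_def)
    qed
  next
    assume R: "centralizes M (conjugate_set P r) w"
    show "centralizes M P z"
      unfolding centralizes_def
    proof
      fix p assume p: "p \<in> P"
      then obtain q where q: "q \<in> carrier M" "p \<otimes> r = r \<otimes> q" using ribbonD(3)[OF r] by blast
      then have "q \<in> conjugate_set P r" using p by (intro conjugate_set_memI)
      then show "z \<otimes> p = p \<otimes> z" using R * q carr p by (auto simp: centralizes_def)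
    qed
  qed
qed

end

context lcm_garside_monoid
begin

text \<open>
  This is \<open>z\<^sub>P\<close>.
\<close>

abbreviation central_elt :: "'a set \<Rightarrow> 'a" where
  "central_elt P \<equiv> least_central_power M P (head M P \<Delta>)"

lemma central_elt:
  assumes P: "standard_parabolic M P"
  shows "\<exists>k. central_elt P = head M P \<Delta> [^] Suc k" "centralizes M P (central_elt P)"
    "central_elt P \<in> P"
proof -
  let ?R = "\<lambda>k::nat. 0 < k \<and> centralizes M P (head M P \<Delta> [^] k)"
  have least: "?R (LEAST k. ?R k)" using central_power[OF P] by (rule LeastI_ex)
  then obtain k where "(LEAST k. ?R k) = Suc k" using gr0_implies_Suc by blast
  then show "\<exists>k. central_elt P = head M P \<Delta> [^] Suc k"
    unfolding least_central_power_def by (intro exI[of _ k]) simp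
  show "centralizes M P (central_elt P)"
    unfolding least_central_power_def using least by (rule conjunct2)
  show "central_elt P \<in> P"
    unfolding least_central_power_def by (rule parabolic_pow[OF P head_mem[OF P Delta_carrier]])
qed

text \<open>
  Powers of \<open>\<Delta>\<^sub>P\<close> correspond to the same powers of \<open>\<Delta>\<^sub>Q\<close>, and one is central exactly when the other is,
  so the least exponents agree.
\<close>

lemma central_elt_ribbon:
  assumes P: "standard_parabolic M P" and r: "ribbon M P r"
  shows "central_elt P \<otimes> r = r \<otimes> central_elt (conjugate_set P r)"
proof -
  let ?Q = "conjugate_set P r"
  note Q = conjunct1[OF ribbon_conjugate[OF P r]] and conj = conjunct2[OF ribbon_conjugate[OF P r]]
  have d: "head M P \<Delta> \<in> carrier M" "head M ?Q \<Delta> \<in> carrier M"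
    using parabolic_carrier head_mem P Q Delta_carrier by auto
  have pow: "head M P \<Delta> [^] k \<otimes> r = r \<otimes> head M ?Q \<Delta> [^] k" for k :: nat
    using conjugate_pow[OF conj] d ribbonD(1)[OF r] by simp
  have "centralizes M P (head M P \<Delta> [^] k) \<longleftrightarrow> centralizes M ?Q (head M ?Q \<Delta> [^] k)" for k :: nat
    using centralizes_conjugate_set_iff[OF P r _ pow] d parabolic_carrier[OF Q] by blast
  then show ?thesis
    unfolding least_central_power_def using pow by simp
qed

text \<open>
  Central elements of \<open>P\<close> serve as common denominators for the group generated by \<open>P\<close>. Each atom divides
  \<open>z\<^sub>P\<close>, so a product of \<open>n\<close> atoms divides \<open>z\<^sub>P\<^sup>n\<close>.
\<close>

lemma divides_central:
  assumes P: "standard_parabolic M P" and x: "x \<in> P"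
  shows "\<exists>w\<in>P. \<exists>y\<in>P. centralizes M P w \<and> x \<otimes> y = w"
  using P x
proof (induction x rule: parabolic_induct)
  case one
  have "centralizes M P \<one>" "\<one> \<otimes> \<one> = \<one>"
    using parabolic_carrier[OF P] by (auto simp: centralizes_def)
  then show ?case using parabolic_one[OF P] by blast
next
  case (mult a x)
  note carr = parabolic_carrier[OF P]
  let ?z = "central_elt P"
  note z = central_elt(2,3)[OF P]
  obtain k where k: "?z = head M P \<Delta> [^] Suc k" using central_elt(1)[OF P] by blast
  have dP: "head M P \<Delta> \<in> carrier M" using carr head_mem[OF P Delta_carrier] by blast
  have ac: "a \<in> carrier M" by (rule carr[OF mult.hyps(2)])
  have "?z = head M P \<Delta> \<otimes> head M P \<Delta> [^] k" unfolding k using dP by (rule nat_pow_Suc2)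
  then have "a divides ?z"
    using atom_divides_head_Delta[OF P mult.hyps(1,2)] ac dP by (auto intro: divides_prod_r)
  then obtain c where c: "c \<in> carrier M" "?z = a \<otimes> c" by blast
  then have "a \<otimes> c \<in> P" using z(2) by simp
  then have cP: "c \<in> P" using parabolic_mult_iff[OF P ac c(1)] by blast
  obtain w y where wy: "w \<in> P" "y \<in> P" "centralizes M P w" "x \<otimes> y = w"
    using mult.IH by blast
  have cs: "x \<in> carrier M" "y \<in> carrier M" "w \<in> carrier M" "?z \<in> carrier M"
    using carr mult.hyps wy z by auto
  have "a \<otimes> x \<otimes> (y \<otimes> c) = a \<otimes> (x \<otimes> y) \<otimes> c" using cs c ac by (simp add: m_assoc)
  also have "\<dots> = a \<otimes> (w \<otimes> c)" using wy(4) cs c ac by (simp add: m_assoc)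
  also have "\<dots> = a \<otimes> (c \<otimes> w)" using wy(3) cP by (simp add: centralizes_def)
  also have "\<dots> = ?z \<otimes> w" using c ac cs by (simp add: m_assoc)
  finally have eq: "a \<otimes> x \<otimes> (y \<otimes> c) = ?z \<otimes> w" .
  have "centralizes M P (?z \<otimes> w)"
    unfolding centralizes_def
  proof
    fix v assume v: "v \<in> P"
    have vc: "v \<in> carrier M" by (rule carr[OF v])
    have "?z \<otimes> w \<otimes> v = ?z \<otimes> (v \<otimes> w)" using wy(3) v vc cs by (simp add: centralizes_def m_assoc)
    also have "\<dots> = ?z \<otimes> v \<otimes> w" using vc cs by (simp add: m_assoc)
    also have "\<dots> = v \<otimes> ?z \<otimes> w" using z(1) v by (simp add: centralizes_def)
    finally show "?z \<otimes> w \<otimes> v = v \<otimes> (?z \<otimes> w)" using vc cs by (simp add: m_assoc)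
  qed
  with eq show ?case
    using parabolic_mult[OF P] z(2) wy(1,2) cP by blast
qed

lemma divides_central_commute:
  assumes P: "standard_parabolic M P" and "x \<in> P" "y \<in> P" "centralizes M P w" "w \<in> P" "x \<otimes> y = w"
  shows "y \<otimes> x = w"
proof -
  have c: "x \<in> carrier M" "y \<in> carrier M" "w \<in> carrier M"
    using assms parabolic_carrier[OF P] by auto
  have "x \<otimes> (y \<otimes> x) = w \<otimes> x" using assms(6) c by (simp add: m_assoc[symmetric])
  also have "\<dots> = x \<otimes> w" using assms(2,4) by (simp add: centralizes_def)
  finally show ?thesis using l_cancel[of x "y \<otimes> x" w] c by simp
qed

end

section \<open>Maximal ribbons and coprimality\<close>

context garside_monoid
begin

text \<open>
  The ribbon condition \<open>m \<preceq> p m\<close> survives lcms because left multiplication by \<open>p\<close> is compatible with them;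
  reducedness survives as long as the lcm divides a reduced element.
\<close>

lemma ribbon_lcm:
  assumes P: "standard_parabolic M P" and g: "reduced M P g"
    and s: "ribbon M P s" "s divides g" and t: "ribbon M P t" "t divides g"
    and m: "m \<in> carrier M" "m lcmof s t"
  shows "ribbon M P m" "m divides g"
proof -
  note gc = reduced_carrier[OF g] and sc = ribbonD(1)[OF s(1)] and tc = ribbonD(1)[OF t(1)]
  note carr = parabolic_carrier[OF P]
  have lcm: "s divides m" "t divides m"
    "\<And>y. y \<in> carrier M \<Longrightarrow> s divides y \<Longrightarrow> t divides y \<Longrightarrow> m divides y"
    using m(2) by (auto simp: islcm_def)
  show mg: "m divides g" using lcm(3)[OF gc s(2) t(2)] .
  have "m divides (p \<otimes> m)" if p: "p \<in> P" for p
  proof (rule lcm(3))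
    show "p \<otimes> m \<in> carrier M" using p carr m by simp
    have "s divides (p \<otimes> s)" "t divides (p \<otimes> t)" using s t p by (auto simp: ribbon_def)
    moreover have "(p \<otimes> s) divides (p \<otimes> m)" "(p \<otimes> t) divides (p \<otimes> m)"
      using lcm(1,2) m(1) carr[OF p] sc tc by simp_all
    ultimately show "s divides (p \<otimes> m)" "t divides (p \<otimes> m)"
      using divides_trans sc tc by blast+
  qed
  with reduced_divisor[OF P g mg m(1)] show "ribbon M P m" by (simp add: ribbon_def)
qed

text \<open>
  A ribbon dividing \<open>g\<close> with minimal cofactor is maximal, and closure under lcms turns the maximal one into a
  greatest one. This justifies the definite description in the definition.
\<close>

lemma max_ribbon:
  assumes P: "standard_parabolic M P" and g: "reduced M P g"
  shows "ribbon M P (max_ribbon M P g)" "max_ribbon M P g divides g"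
    and "\<And>s. ribbon M P s \<Longrightarrow> s divides g \<Longrightarrow> s divides max_ribbon M P g"
proof -
  note gc = reduced_carrier[OF g]
  let ?C = "{c \<in> carrier M. \<exists>r. ribbon M P r \<and> g = r \<otimes> c}"
  have "ribbon M P \<one>"
    using reduced_divisor[OF P g one_divides[OF gc]] parabolic_carrier[OF P] one_divides
    by (auto simp: ribbon_def)
  then have "g \<in> ?C" using gc by force
  then obtain c where c: "c \<in> ?C" and min: "\<And>y. y \<in> ?C \<Longrightarrow> is_factor M y c \<Longrightarrow> y = c"
    using factor_minimal_exists[of ?C g] by blast
  then obtain r where r: "ribbon M P r" "g = r \<otimes> c" "c \<in> carrier M" by blast
  have rc: "r \<in> carrier M" by (rule ribbonD(1)[OF r(1)])
  have rg: "r divides g" using r by blast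
  have maximal: "s = r" if s: "ribbon M P s" "s divides g" "r divides s" for s
  proof -
    obtain u where u: "u \<in> carrier M" "s = r \<otimes> u" using s by blast
    obtain c' where c': "c' \<in> carrier M" "g = s \<otimes> c'" using s by blast
    have "r \<otimes> c = r \<otimes> (u \<otimes> c')" using r(2) u c' rc by (simp add: m_assoc)
    then have "c = u \<otimes> c'" using l_cancel[of r c "u \<otimes> c'"] r rc u c' by simp
    moreover have "c' \<in> ?C" using c' s(1) by blast
    ultimately have "c' = c" using min[of c'] right_factor[OF u(1) c'(1)] by simp
    then show ?thesis
      using \<open>c = u \<otimes> c'\<close> mult_eq_right_iff[of u c'] u c' rc by simp
  qed
  have greatest: "s divides r" if s: "ribbon M P s" "s divides g" for s
  proof -
    have sc: "s \<in> carrier M" by (rule ribbonD(1)[OF s(1)])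
    obtain m where m: "m \<in> carrier M" "m lcmof s r" using right_lcm_exists[OF sc rc] by blast
    have "m = r"
      using maximal ribbon_lcm[OF P g s r(1) rg m] m(2) by (simp add: islcm_def)
    with m(2) show ?thesis by (simp add: islcm_def)
  qed
  have "max_ribbon M P g = r"
    unfolding max_ribbon_def
  proof (rule the_equality)
    show "ribbon M P r \<and> r divides g \<and> (\<forall>s. ribbon M P s \<and> s divides g \<and> r divides s \<longrightarrow> s = r)"
      using r(1) rg maximal by blast
    fix r' assume r': "ribbon M P r' \<and> r' divides g \<and>
      (\<forall>s. ribbon M P s \<and> s divides g \<and> r' divides s \<longrightarrow> s = r')"
    then have "r' divides r" using greatest by blast
    with r' r(1) rg show "r' = r" by blast
  qed
  with r(1) rg greatest show "ribbon M P (max_ribbon M P g)" "max_ribbon M P g divides g"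
    "\<And>s. ribbon M P s \<Longrightarrow> s divides g \<Longrightarrow> s divides max_ribbon M P g" by simp_all
qed

lemma tail:
  assumes P: "standard_parabolic M P" and g: "g \<in> carrier M"
  shows "g = head M P g \<otimes> tail M P g" "reduced M P (tail M P g)"
proof -
  note carr = parabolic_carrier[OF P] and h = head_mem[OF P g]
  obtain t where t: "t \<in> carrier M" "g = head M P g \<otimes> t" using head_divides[OF P g] by blast
  have tail_eq: "tail M P g = t"
    unfolding tail_def
  proof (rule the_equality)
    fix t' assume "t' \<in> carrier M \<and> g = head M P g \<otimes> t'"
    with t carr[OF h] show "t' = t" using l_cancel[of "head M P g" t' t] by simp
  qed (use t in blast)
  with t show "g = head M P g \<otimes> tail M P g" by simp
  show "reduced M P (tail M P g)"
    unfolding tail_eq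
  proof (rule reducedI[OF P t(1)])
    fix p assume p: "p \<in> P" "p divides t"
    have "(head M P g \<otimes> p) divides (head M P g \<otimes> t)" using p carr h t(1) by simp
    then have "(head M P g \<otimes> p) divides g" unfolding t(2)[symmetric] .
    then have "(head M P g \<otimes> p) divides (head M P g \<otimes> \<one>)"
      using head_greatest[OF P g] parabolic_mult[OF P h p(1)] carr h by simp
    then have "p divides \<one>" using divides_mult_l[of p \<one> "head M P g"] carr h p by blast
    then show "p = \<one>" using divides_one carr p by blast
  qed
qed

end

context lcm_garside_monoid
begin

text \<open>
  Each application of \<open>elementary_ribbon\<close> strips one factor \<open>\<Delta>\<^sub>Q\<close>; its output is a nontrivial reduced element
  again, so it can serve as the next \<open>u\<close>. The exponent is a successor because the element that results
  is a ribbon only after at least one step.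
\<close>

lemma ribbon_below_of_divides_power_mult:
  assumes Q: "standard_parabolic M Q" and c: "c \<in> carrier M"
    and u: "reduced M Q u" "u \<noteq> \<one>" "u divides (head M Q \<Delta> [^] Suc k \<otimes> c)"
  shows "\<exists>d. ribbon M Q d \<and> d \<noteq> \<one> \<and> d divides c"
  using u
proof (induction k arbitrary: u)
  let ?d = "head M Q \<Delta>"
  have dc: "?d \<in> carrier M" using parabolic_carrier[OF Q] head_mem[OF Q Delta_carrier] by blast
  have step: "\<exists>d. ribbon M Q d \<and> d \<noteq> \<one> \<and> d divides (?d [^] k \<otimes> c)"
    if u: "reduced M Q u" "u \<noteq> \<one>" "u divides (?d [^] Suc k \<otimes> c)" for u k
  proof -
    obtain d where d: "ribbon M Q d" "d \<noteq> \<one>"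
      "\<And>x. x \<in> carrier M \<Longrightarrow> u divides (?d \<otimes> x) \<Longrightarrow> d divides x"
      using elementary_ribbon[OF Q u(1,2)] by blast
    have "?d [^] Suc k \<otimes> c = ?d \<otimes> (?d [^] k \<otimes> c)"
      using dc c by (metis m_assoc nat_pow_Suc2 nat_pow_closed)
    with d u(3) dc c show ?thesis by auto
  qed
  {
    case 0
    then show ?case using step[of u 0] c by simp
  next
    case (Suc k)
    then obtain d where d: "ribbon M Q d" "d \<noteq> \<one>" "d divides (?d [^] Suc k \<otimes> c)"
      using step by blast
    then show ?case using Suc.IH[OF ribbonD(2)[OF d(1)]] by blast
  }
qed

lemma coprime_central_mult:
  assumes Q: "standard_parabolic M Q" and c: "reduced M Q c"
    and no_ribbon: "\<And>d. ribbon M Q d \<Longrightarrow> d divides c \<Longrightarrow> d = \<one>"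
  shows "\<one> gcdof c (central_elt Q \<otimes> c)"
proof -
  have cc: "c \<in> carrier M" by (rule reduced_carrier[OF c])
  obtain k where k: "central_elt Q = head M Q \<Delta> [^] Suc k" using central_elt(1)[OF Q] by blast
  have zc: "central_elt Q \<in> carrier M" using central_elt(3)[OF Q] parabolic_carrier[OF Q] by blast
  have "y = \<one>" if y: "y \<in> carrier M" "y divides c" "y divides (central_elt Q \<otimes> c)" for y
  proof (rule ccontr)
    assume "y \<noteq> \<one>"
    then obtain d where "ribbon M Q d" "d \<noteq> \<one>" "d divides c"
      using ribbon_below_of_divides_power_mult[OF Q cc reduced_divisor[OF Q c y(2,1)]] y(3) k by auto
    then show False using no_ribbon by blast
  qed
  then show ?thesis
    using one_divides cc zc unfolding isgcd_def by auto
qed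

text \<open>
  If a \<open>Q\<close>-ribbon \<open>d\<close> divided \<open>c\<close>, then \<open>r d\<close> would be a \<open>P\<close>-ribbon dividing \<open>t\<close>, so \<open>d = \<one>\<close> by maximality
  of \<open>r\<close>.
\<close>

lemma coprime_after_max_ribbon:
  assumes P: "standard_parabolic M P" and t: "reduced M P t" "t = max_ribbon M P t \<otimes> c"
    and c: "c \<in> carrier M"
  shows "\<one> gcdof c (central_elt (conjugate_set P (max_ribbon M P t)) \<otimes> c)"
proof -
  let ?r = "max_ribbon M P t"
  let ?Q = "conjugate_set P ?r"
  note r = max_ribbon[OF P t(1)]
  have rc: "?r \<in> carrier M" by (rule ribbonD(1)[OF r(1)])
  have Q: "standard_parabolic M ?Q" using ribbon_conjugate[OF P r(1)] ..
  show ?thesis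
  proof (rule coprime_central_mult[OF Q])
    show "reduced M ?Q c" using ribbon_mult_iff(1)[OF P r(1) Q c] t by simp
    fix d assume d: "ribbon M ?Q d" "d divides c"
    have dc: "d \<in> carrier M" by (rule ribbonD(1)[OF d(1)])
    have "(?r \<otimes> d) divides (?r \<otimes> c)" using d dc c rc by simp
    then have div: "(?r \<otimes> d) divides t" using t(2) by simp
    then have "reduced M P (?r \<otimes> d)" using reduced_divisor[OF P t(1)] rc dc by simp
    then have "ribbon M P (?r \<otimes> d)" using ribbon_mult_iff(2)[OF P r(1) Q dc] d(1) by simp
    then have "(?r \<otimes> d) divides (?r \<otimes> \<one>)" using r(3) div rc by simp
    then have "d divides \<one>" using divides_mult_l[OF dc one_closed rc] by blast
    then show "d = \<one>" using divides_one dc by blast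
  qed
qed

end

section \<open>Parabolic subgroups of the group of fractions\<close>

locale lcm_garside_fractions = lcm_garside_monoid +
  fixes G :: "('a, 'g) monoid_scheme"
  assumes fractions: "group_of_fractions M G"

sublocale lcm_garside_fractions \<subseteq> G: group G
  using fractions by (simp add: group_of_fractions_def)

context lcm_garside_fractions
begin

lemma M_G: "x \<in> carrier M \<Longrightarrow> x \<in> carrier G"
  using fractions submonoid.subset unfolding group_of_fractions_def by blast

lemma one_G: "\<one>\<^bsub>G\<^esub> = \<one>"
  using fractions by (simp add: group_of_fractions_def)

lemma mult_G: "\<lbrakk>x \<in> carrier M; y \<in> carrier M\<rbrakk> \<Longrightarrow> x \<otimes>\<^bsub>G\<^esub> y = x \<otimes> y"
  using fractions by (simp add: group_of_fractions_def)

lemma G_fraction: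
  assumes "x \<in> carrier G"
  obtains a b where "a \<in> carrier M" "b \<in> carrier M" "x = inv\<^bsub>G\<^esub> a \<otimes>\<^bsub>G\<^esub> b"
  using fractions assms unfolding group_of_fractions_def by blast

lemma inv_mult_cancel:
  assumes "a \<in> carrier G" "z \<in> carrier G"
  shows "a \<otimes>\<^bsub>G\<^esub> (inv\<^bsub>G\<^esub> a \<otimes>\<^bsub>G\<^esub> z) = z" "inv\<^bsub>G\<^esub> a \<otimes>\<^bsub>G\<^esub> (a \<otimes>\<^bsub>G\<^esub> z) = z"
  using assms by (simp_all flip: G.m_assoc)

lemma conj_by_closed: "\<lbrakk>g \<in> carrier G; x \<in> carrier G\<rbrakk> \<Longrightarrow> conj_by G g x \<in> carrier G"
  by (simp add: conj_by_def)

lemma conj_by_eqI: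
  assumes "x \<otimes> g = g \<otimes> y" "x \<in> carrier M" "g \<in> carrier M" "y \<in> carrier M"
  shows "conj_by G g x = y"
proof -
  have "conj_by G g x = inv\<^bsub>G\<^esub> g \<otimes>\<^bsub>G\<^esub> (x \<otimes>\<^bsub>G\<^esub> g)"
    using assms M_G by (simp add: conj_by_def G.m_assoc)
  also have "x \<otimes>\<^bsub>G\<^esub> g = g \<otimes>\<^bsub>G\<^esub> y" using assms mult_G by simp
  finally show ?thesis using assms M_G by (simp add: G.m_assoc[symmetric])
qed

lemma conj_by_mult:
  assumes "g \<in> carrier G" "h \<in> carrier G" "x \<in> carrier G"
  shows "conj_by G (g \<otimes>\<^bsub>G\<^esub> h) x = conj_by G h (conj_by G g x)"
  using assms by (simp add: conj_by_def G.inv_mult_group G.m_assoc)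

lemma conj_by_hom: "g \<in> carrier G \<Longrightarrow> group_hom G G (conj_by G g)"
proof (intro group_hom.intro group_hom_axioms.intro homI)
  fix x y assume "g \<in> carrier G" "x \<in> carrier G" "y \<in> carrier G"
  then show "conj_by G g (x \<otimes>\<^bsub>G\<^esub> y) = conj_by G g x \<otimes>\<^bsub>G\<^esub> conj_by G g y"
    by (simp add: conj_by_def G.m_assoc inv_mult_cancel)
qed (simp_all add: conj_by_closed G.group_axioms)

lemma conj_by_inj: "g \<in> carrier G \<Longrightarrow> inj_on (conj_by G g) (carrier G)"
  by (rule inj_onI) (simp add: conj_by_def)

lemma conj_by_inv:
  assumes "g \<in> carrier G" "x \<in> carrier G"
  shows "conj_by G g (conj_by G (inv\<^bsub>G\<^esub> g) x) = x"
  using assms conj_by_mult[of "inv\<^bsub>G\<^esub> g" g x] by (simp add: conj_by_def)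

lemma parabolic_G: "\<lbrakk>standard_parabolic M P; x \<in> P\<rbrakk> \<Longrightarrow> x \<in> carrier G"
  using parabolic_carrier M_G by blast

lemma generate_G: "standard_parabolic M P \<Longrightarrow> generate G P \<subseteq> carrier G"
  using parabolic_G by (intro G.generate_incl) blast

lemma conj_by_generate:
  assumes "standard_parabolic M P" "g \<in> carrier G"
  shows "conj_by G g ` generate G P = generate G (conj_by G g ` P)"
proof -
  have "P \<subseteq> carrier G" using parabolic_G[OF assms(1)] by blast
  then show ?thesis using group_hom.generate_img[OF conj_by_hom[OF assms(2)]] by simp
qed

lemma conj_by_generate_self:
  assumes P: "standard_parabolic M P" and h: "h \<in> P"
  shows "conj_by G h ` generate G P = generate G P"
proof -
  have "P \<subseteq> carrier G" using parabolic_G[OF P] by blast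
  then interpret S: subgroup "generate G P" G by (rule G.generate_is_subgroup)
  have hS: "h \<in> generate G P" using h by (rule generate.incl)
  have closed: "conj_by G g x \<in> generate G P" if "g \<in> generate G P" "x \<in> generate G P" for g x
    using that by (simp add: conj_by_def)
  show ?thesis
  proof
    show "conj_by G h ` generate G P \<subseteq> generate G P" using closed hS by blast
    show "generate G P \<subseteq> conj_by G h ` generate G P"
    proof
      fix x assume x: "x \<in> generate G P"
      then have "conj_by G (inv\<^bsub>G\<^esub> h) x \<in> generate G P" using closed hS by blast
      moreover have "x = conj_by G h (conj_by G (inv\<^bsub>G\<^esub> h) x)"
        using conj_by_inv[of h x] hS x S.mem_carrier by simp
      ultimately show "x \<in> conj_by G h ` generate G P" by blast
    qed
  qed
qed

lemma conj_by_central_elt_self: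
  assumes P: "standard_parabolic M P" and h: "h \<in> P"
  shows "conj_by G h (central_elt P) = central_elt P"
  using central_elt(2,3)[OF P] h parabolic_carrier[OF P]
  by (intro conj_by_eqI) (auto simp: centralizes_def)

lemma conj_by_ribbon_image:
  assumes P: "standard_parabolic M P" and r: "ribbon M P r"
  shows "conj_by G r ` P = conjugate_set P r"
proof
  note rc = ribbonD(1)[OF r] and carr = parabolic_carrier[OF P]
  show "conj_by G r ` P \<subseteq> conjugate_set P r"
  proof
    fix q assume "q \<in> conj_by G r ` P"
    then obtain p where p: "p \<in> P" "q = conj_by G r p" by blast
    obtain q' where q': "q' \<in> carrier M" "p \<otimes> r = r \<otimes> q'" using ribbonD(3)[OF r p(1)] by blast
    then have "q = q'" using p conj_by_eqI[OF q'(2)] carr rc by simp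
    with p q' show "q \<in> conjugate_set P r" by (intro conjugate_set_memI) auto
  qed
  show "conjugate_set P r \<subseteq> conj_by G r ` P"
  proof
    fix q assume "q \<in> conjugate_set P r"
    then obtain p where p: "p \<in> P" "q \<in> carrier M" "p \<otimes> r = r \<otimes> q" by (rule conjugate_set_memE)
    then have "q = conj_by G r p" using conj_by_eqI[OF p(3)] carr rc by simp
    with p show "q \<in> conj_by G r ` P" by blast
  qed
qed

text \<open>
  Every element of the group generated by \<open>P\<close> is a fraction whose denominator is central in \<open>P\<close>; because
  such denominators commute with numerators, products need no common multiples.
\<close>

lemma generate_clear_denominator:
  assumes P: "standard_parabolic M P" and x: "x \<in> generate G P"
  shows "\<exists>w\<in>P. \<exists>y\<in>P. centralizes M P w \<and> w \<otimes>\<^bsub>G\<^esub> x = y"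
  using x
proof (induction rule: generate.induct)
  note carr = parabolic_carrier[OF P]
  have one: "\<one> \<in> P" "centralizes M P \<one>"
    using parabolic_one[OF P] carr by (auto simp: centralizes_def)
  {
    case one
    show ?case using \<open>\<one> \<in> P\<close> \<open>centralizes M P \<one>\<close> one_G mult_G[of \<one> \<one>] by auto
  next
    case (incl h)
    then show ?case using one carr mult_G[of \<one> h] by (intro bexI[of _ \<one>] bexI[of _ h]) auto
  next
    case (inv h)
    obtain w y where wy: "w \<in> P" "y \<in> P" "centralizes M P w" "h \<otimes> y = w"
      using divides_central[OF P inv] by blast
    have "y \<otimes> h = w" using divides_central_commute[OF P inv wy(2,3,1,4)] .
    then have "w = y \<otimes>\<^bsub>G\<^esub> h" using mult_G wy inv carr by simp
    then have "w \<otimes>\<^bsub>G\<^esub> inv\<^bsub>G\<^esub> h = y"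
      using wy inv parabolic_G[OF P] by (simp add: G.m_assoc)
    with wy show ?case by blast
  next
    case (eng x1 x2)
    obtain w1 y1 where 1: "w1 \<in> P" "y1 \<in> P" "centralizes M P w1" "w1 \<otimes>\<^bsub>G\<^esub> x1 = y1"
      using eng.IH(1) by blast
    obtain w2 y2 where 2: "w2 \<in> P" "y2 \<in> P" "centralizes M P w2" "w2 \<otimes>\<^bsub>G\<^esub> x2 = y2"
      using eng.IH(2) by blast
    have c: "x1 \<in> carrier G" "x2 \<in> carrier G" "w1 \<in> carrier G" "w2 \<in> carrier G" "y1 \<in> carrier G"
      using eng.hyps generate_G[OF P] 1 2 parabolic_G[OF P] by auto
    have m: "w1 \<in> carrier M" "w2 \<in> carrier M" "y1 \<in> carrier M" "y2 \<in> carrier M"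
      using 1 2 carr by auto
    have "(w2 \<otimes> w1) \<otimes>\<^bsub>G\<^esub> (x1 \<otimes>\<^bsub>G\<^esub> x2) = w2 \<otimes>\<^bsub>G\<^esub> (w1 \<otimes>\<^bsub>G\<^esub> x1) \<otimes>\<^bsub>G\<^esub> x2"
      using c m by (simp add: G.m_assoc flip: mult_G)
    also have "\<dots> = (w2 \<otimes> y1) \<otimes>\<^bsub>G\<^esub> x2" using 1(4) m by (simp add: mult_G)
    also have "\<dots> = (y1 \<otimes> w2) \<otimes>\<^bsub>G\<^esub> x2" using 2(3) 1(2) by (simp add: centralizes_def)
    also have "\<dots> = y1 \<otimes>\<^bsub>G\<^esub> (w2 \<otimes>\<^bsub>G\<^esub> x2)" using c m by (simp add: G.m_assoc flip: mult_G)
    also have "\<dots> = y1 \<otimes> y2" using 2(4) m by (simp add: mult_G)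
    finally have eq: "(w2 \<otimes> w1) \<otimes>\<^bsub>G\<^esub> (x1 \<otimes>\<^bsub>G\<^esub> x2) = y1 \<otimes> y2" .
    have "centralizes M P (w2 \<otimes> w1)"
      unfolding centralizes_def
    proof
      fix v assume v: "v \<in> P"
      then have "w2 \<otimes> w1 \<otimes> v = w2 \<otimes> (v \<otimes> w1)" using 1(3) m carr by (simp add: centralizes_def m_assoc)
      also have "\<dots> = w2 \<otimes> v \<otimes> w1" using m carr v by (simp add: m_assoc)
      also have "\<dots> = v \<otimes> w2 \<otimes> w1" using 2(3) v by (simp add: centralizes_def)
      finally show "w2 \<otimes> w1 \<otimes> v = v \<otimes> (w2 \<otimes> w1)" using m carr v by (simp add: m_assoc)
    qed
    with eq show ?case using parabolic_mult[OF P] 1 2 by blast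
  }
qed

lemma generate_Int_monoid:
  assumes P: "standard_parabolic M P"
  shows "generate G P \<inter> carrier M = P"
proof
  show "P \<subseteq> generate G P \<inter> carrier M"
    using parabolic_carrier[OF P] by (auto intro: generate.incl)
  show "generate G P \<inter> carrier M \<subseteq> P"
  proof
    fix x assume x: "x \<in> generate G P \<inter> carrier M"
    then obtain w where w: "w \<in> P" "w \<otimes>\<^bsub>G\<^esub> x \<in> P" using generate_clear_denominator[OF P] by blast
    then show "x \<in> P" using x parabolic_carrier[OF P] mult_G parabolic_mult_iff[OF P, of w x] by simp
  qed
qed

text \<open>
  Compare the reduced fraction with one over \<open>P\<close>, with denominator \<open>w\<close>: a common left-multiple of the two
  denominators shows that \<open>w = e a\<close>, so \<open>a\<close> is a factor of an element of \<open>P\<close>.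
\<close>

lemma reduced_denominator_mem:
  assumes P: "standard_parabolic M P" and ab: "a \<in> carrier M" "b \<in> carrier M" "\<one> gcdof a b"
    and x: "inv\<^bsub>G\<^esub> a \<otimes>\<^bsub>G\<^esub> b \<in> generate G P"
  shows "a \<in> P"
proof -
  obtain w y where wy: "w \<in> P" "y \<in> P" "w \<otimes>\<^bsub>G\<^esub> (inv\<^bsub>G\<^esub> a \<otimes>\<^bsub>G\<^esub> b) = y"
    using generate_clear_denominator[OF P x] by blast
  have wyc: "w \<in> carrier M" "y \<in> carrier M" using wy parabolic_carrier[OF P] by auto
  obtain m where "is_left_lcm M m w a" using left_lcm_exists wyc ab by blast
  then obtain c f where cf: "c \<in> carrier M" "f \<in> carrier M" "c \<otimes> w = f \<otimes> a"
    unfolding is_left_lcm_def is_least_def right_divides_def by blast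
  have "c \<otimes> y = c \<otimes>\<^bsub>G\<^esub> (w \<otimes>\<^bsub>G\<^esub> (inv\<^bsub>G\<^esub> a \<otimes>\<^bsub>G\<^esub> b))"
    using cf wyc wy(3) by (simp add: mult_G)
  also have "\<dots> = (c \<otimes> w) \<otimes>\<^bsub>G\<^esub> (inv\<^bsub>G\<^esub> a \<otimes>\<^bsub>G\<^esub> b)"
    unfolding mult_G[OF cf(1) wyc(1), symmetric]
    using cf(1) wyc(1) ab(1,2) M_G by (simp add: G.m_assoc)
  also have "\<dots> = f \<otimes> b"
    unfolding cf(3) using cf ab M_G by (simp add: G.m_assoc inv_mult_cancel flip: mult_G)
  finally have "c \<otimes> y = f \<otimes> b" .
  then have "c divides (f \<otimes> a)" "c divides (f \<otimes> b)"
    using wyc dividesI[of w M "f \<otimes> a" c] dividesI[of y M "f \<otimes> b" c] cf(3) by simp_all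
  then have "c divides f" using coprime_mult_divides[OF ab(3)] cf ab by blast
  then obtain e where e: "e \<in> carrier M" "f = c \<otimes> e" by blast
  have "c \<otimes> w = c \<otimes> (e \<otimes> a)" using cf e ab by (simp add: m_assoc)
  then have "w = e \<otimes> a" using l_cancel[of c w "e \<otimes> a"] cf e ab wyc by simp
  then show ?thesis using wy(1) e ab parabolic_mult_iff[OF P, of e a] by simp
qed

lemma centralizes_monoid_central:
  assumes w: "w \<in> carrier M" "centralizes M (carrier M) w" and x: "x \<in> carrier G"
  shows "w \<otimes>\<^bsub>G\<^esub> x = x \<otimes>\<^bsub>G\<^esub> w"
proof -
  obtain a b where ab: "a \<in> carrier M" "b \<in> carrier M" "x = inv\<^bsub>G\<^esub> a \<otimes>\<^bsub>G\<^esub> b"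
    using G_fraction[OF x] by blast
  note c = M_G[OF ab(1)] M_G[OF ab(2)] M_G[OF w(1)]
  have comm: "w \<otimes>\<^bsub>G\<^esub> v = v \<otimes>\<^bsub>G\<^esub> w" if "v \<in> carrier M" for v
    using w that mult_G by (simp add: centralizes_def)
  have ax: "a \<otimes>\<^bsub>G\<^esub> x = b" using ab(3) c by (simp add: G.m_assoc[symmetric])
  have "a \<otimes>\<^bsub>G\<^esub> (w \<otimes>\<^bsub>G\<^esub> x) = w \<otimes>\<^bsub>G\<^esub> (a \<otimes>\<^bsub>G\<^esub> x)"
    using comm[OF ab(1)] c x by (simp add: G.m_assoc[symmetric])
  also have "\<dots> = a \<otimes>\<^bsub>G\<^esub> (x \<otimes>\<^bsub>G\<^esub> w)"
    using comm[OF ab(2)] c x ax by (simp add: G.m_assoc[symmetric])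
  finally show ?thesis using c x by simp
qed

text \<open>
  Multiplying \<open>g\<close> by a suitable central element of \<open>M\<close> clears its denominator and leaves conjugation unchanged.
\<close>

lemma conj_by_monoid_representative:
  assumes g: "g \<in> carrier G"
  obtains m where "m \<in> carrier M" "\<And>x. x \<in> carrier G \<Longrightarrow> conj_by G g x = conj_by G m x"
proof -
  obtain a b where ab: "a \<in> carrier M" "b \<in> carrier M" "g = inv\<^bsub>G\<^esub> a \<otimes>\<^bsub>G\<^esub> b"
    using G_fraction[OF g] by blast
  obtain w y where wy: "w \<in> carrier M" "y \<in> carrier M" "centralizes M (carrier M) w" "a \<otimes> y = w"
    using divides_central[OF parabolic_whole ab(1)] by blast
  note c = M_G[OF ab(1)] M_G[OF ab(2)] M_G[OF wy(1)] M_G[OF wy(2)]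
  have central: "w \<otimes>\<^bsub>G\<^esub> x = x \<otimes>\<^bsub>G\<^esub> w" if "x \<in> carrier G" for x
    using centralizes_monoid_central[OF wy(1,3) that] .
  have "w \<otimes>\<^bsub>G\<^esub> g = inv\<^bsub>G\<^esub> a \<otimes>\<^bsub>G\<^esub> w \<otimes>\<^bsub>G\<^esub> b"
    using ab(3) c central[of "inv\<^bsub>G\<^esub> a"] by (simp flip: G.m_assoc)
  also have "inv\<^bsub>G\<^esub> a \<otimes>\<^bsub>G\<^esub> w = y"
    using mult_G[OF ab(1) wy(2)] wy(4) c inv_mult_cancel(2)[of a y] by simp
  finally have wg: "w \<otimes>\<^bsub>G\<^esub> g = y \<otimes> b"
    using mult_G[OF wy(2) ab(2)] by simp
  have "conj_by G g x = conj_by G (y \<otimes> b) x" if x: "x \<in> carrier G" for x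
  proof -
    have "conj_by G w x = inv\<^bsub>G\<^esub> w \<otimes>\<^bsub>G\<^esub> (w \<otimes>\<^bsub>G\<^esub> x)"
      using c x by (simp add: conj_by_def G.m_assoc central[OF x])
    also have "\<dots> = x" using c x by (simp add: inv_mult_cancel)
    finally show ?thesis
      using conj_by_mult[OF c(3) g x] wg by simp
  qed
  with that[of "y \<otimes> b"] wy ab show thesis by simp
qed

section \<open>The central element of a parabolic subgroup\<close>

text \<open>
  The factors \<open>h \<in> P\<close> and \<open>r\<close> of \<open>b = h r c\<close> are absorbed into the parabolic submonoid, which leaves a
  conjugator \<open>c\<close> coprime to \<open>z\<^sub>Q c\<close>.
\<close>

lemma ribbon_decomposition:
  assumes P: "standard_parabolic M P" and b: "b \<in> carrier M" and c: "c \<in> carrier M"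
    and eq: "head M P b \<otimes> max_ribbon M P (tail M P b) \<otimes> c = b"
  defines "Q \<equiv> conjugate_set P (max_ribbon M P (tail M P b))"
  shows "standard_parabolic M Q" "\<one> gcdof c (central_elt Q \<otimes> c)"
    "conj_by G b ` generate G P = conj_by G c ` generate G Q"
    "conj_by G b (central_elt P) = conj_by G c (central_elt Q)"
proof -
  let ?h = "head M P b" and ?t = "tail M P b"
  let ?r = "max_ribbon M P ?t"
  note h = head_mem[OF P b] and t = tail[OF P b]
  note r = max_ribbon[OF P t(2)]
  have cM: "?h \<in> carrier M" "?t \<in> carrier M" "?r \<in> carrier M"
    using h parabolic_carrier[OF P] reduced_carrier[OF t(2)] ribbonD(1)[OF r(1)] by auto
  note cG = cM[THEN M_G] M_G[OF b] M_G[OF c]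
  have "?h \<otimes> ?t = ?h \<otimes> (?r \<otimes> c)" using t(1) eq cM c by (simp add: m_assoc)
  then have t_eq: "?t = ?r \<otimes> c" using l_cancel[of ?h ?t "?r \<otimes> c"] cM c by simp
  show Q: "standard_parabolic M Q" unfolding Q_def using ribbon_conjugate[OF P r(1)] ..
  show "\<one> gcdof c (central_elt Q \<otimes> c)"
    unfolding Q_def by (rule coprime_after_max_ribbon[OF P t(2) t_eq c])
  have b_eq: "b = ?h \<otimes>\<^bsub>G\<^esub> ?r \<otimes>\<^bsub>G\<^esub> c" using eq cM c by (simp add: mult_G)
  have conj: "conj_by G b x = conj_by G c (conj_by G ?r (conj_by G ?h x))"
    if "x \<in> carrier G" for x
    using that cG conj_by_mult by (subst b_eq) (simp add: conj_by_closed)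
  have "conj_by G b ` generate G P = conj_by G c ` conj_by G ?r ` conj_by G ?h ` generate G P"
    unfolding image_image using generate_G[OF P] conj by (intro image_cong) auto
  also have "\<dots> = conj_by G c ` generate G Q"
    using conj_by_generate_self[OF P h] conj_by_generate[OF P cG(3)] conj_by_ribbon_image[OF P r(1)]
    by (simp add: Q_def)
  finally show "conj_by G b ` generate G P = conj_by G c ` generate G Q" .
  have z: "central_elt P \<in> carrier M" "central_elt Q \<in> carrier M"
    using central_elt(3) P Q parabolic_carrier by auto
  have "conj_by G ?r (central_elt P) = central_elt Q"
    using conj_by_eqI[OF central_elt_ribbon[OF P r(1)]] z cM by (simp add: Q_def)
  then show "conj_by G b (central_elt P) = conj_by G c (central_elt Q)"
    using conj[OF M_G[OF z(1)]] conj_by_central_elt_self[OF P h] by simp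
qed

lemma conj_by_central_elt_eq_fraction:
  assumes "standard_parabolic M Q" "c \<in> carrier M"
  shows "conj_by G c (central_elt Q) = inv\<^bsub>G\<^esub> c \<otimes>\<^bsub>G\<^esub> (central_elt Q \<otimes> c)"
proof -
  have "central_elt Q \<in> carrier M" using central_elt(3) parabolic_carrier assms by blast
  then show ?thesis using assms(2) M_G by (simp add: conj_by_def G.m_assoc flip: mult_G)
qed

text \<open>
  This makes \<open>z\<^sub>K\<close> depend on \<open>K\<close> only. After the decomposition of \<open>m\<close> the last factor \<open>c\<close> is the denominator of
  a reduced fraction lying in the group generated by \<open>P'\<close>, hence \<open>c \<in> P'\<close>, and \<open>Q\<close> and \<open>P'\<close> coincide.
\<close>

lemma conj_by_central_elt:
  assumes P: "standard_parabolic M P" and P': "standard_parabolic M P'" and m: "m \<in> carrier M"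
    and eq: "conj_by G m ` generate G P = generate G P'"
  shows "conj_by G m (central_elt P) = central_elt P'"
proof -
  let ?r = "max_ribbon M P (tail M P m)"
  let ?Q = "conjugate_set P ?r"
  note t = tail[OF P m]
  note r = max_ribbon[OF P t(2)]
  obtain c where c: "c \<in> carrier M" "tail M P m = ?r \<otimes> c" using r(2) by blast
  have "head M P m \<otimes> ?r \<otimes> c = m"
    using t(1) c ribbonD(1)[OF r(1)] parabolic_carrier[OF P head_mem[OF P m]] by (simp add: m_assoc)
  note D = ribbon_decomposition[OF P m c(1) this]
  have zQ: "central_elt ?Q \<in> generate G ?Q" using central_elt(3)[OF D(1)] by (rule generate.incl)
  then have "conj_by G c (central_elt ?Q) \<in> generate G P'" using D(3) eq by blast
  then have cP': "c \<in> P'"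
    using reduced_denominator_mem[OF P' c(1) _ D(2)] conj_by_central_elt_eq_fraction[OF D(1) c(1)]
      central_elt(3)[OF D(1)] parabolic_carrier[OF D(1)] c(1) by simp
  have "conj_by G c ` generate G ?Q = conj_by G c ` generate G P'"
    using D(3) eq conj_by_generate_self[OF P' cP'] by simp
  then have gen: "generate G ?Q = generate G P'"
    by (rule iffD1[OF inj_on_image_eq_iff[OF conj_by_inj[OF M_G[OF c(1)]] generate_G[OF D(1)]
          generate_G[OF P']]])
  have "?Q = P'"
    using generate_Int_monoid[OF D(1)] unfolding gen generate_Int_monoid[OF P'] by (rule sym)
  then show ?thesis unfolding D(4) using conj_by_central_elt_self[OF P' cP'] by (rule ssubst)
qed

text \<open>
  Two presentations of the same subgroup, with conjugators \<open>g\<close> and \<open>g'\<close>, are compared through the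
  quotient \<open>g g'\<^sup>-\<^sup>1\<close>, to which \<open>conj_by_central_elt\<close> applies.
\<close>

lemma parabolic_z_eq:
  assumes P: "standard_parabolic M P" and g: "g \<in> carrier G"
  shows "parabolic_z M \<Delta> G (conj_by G g ` generate G P) = conj_by G g (central_elt P)"
  unfolding parabolic_z_def
proof (rule the_equality)
  show "\<exists>P' g'. standard_parabolic M P' \<and> g' \<in> carrier G \<and>
      conj_by G g ` generate G P = conj_by G g' ` generate G P' \<and>
      conj_by G g (central_elt P) = conj_by G g' (central_elt P')"
    using assms by blast
  fix z
  assume "\<exists>P' g'. standard_parabolic M P' \<and> g' \<in> carrier G \<and>
      conj_by G g ` generate G P = conj_by G g' ` generate G P' \<and>
      z = conj_by G g' (central_elt P')"
  then obtain P' g' where P': "standard_parabolic M P'" and g': "g' \<in> carrier G"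
    and eq: "conj_by G g ` generate G P = conj_by G g' ` generate G P'"
    and z: "z = conj_by G g' (central_elt P')" by blast
  have inv_g': "conj_by G (inv\<^bsub>G\<^esub> g') (conj_by G g' x) = x" if "x \<in> carrier G" for x
    using conj_by_inv[of "inv\<^bsub>G\<^esub> g'" x] that g' by simp
  obtain m where m: "m \<in> carrier M"
    "\<And>x. x \<in> carrier G \<Longrightarrow> conj_by G (g \<otimes>\<^bsub>G\<^esub> inv\<^bsub>G\<^esub> g') x = conj_by G m x"
    using conj_by_monoid_representative[of "g \<otimes>\<^bsub>G\<^esub> inv\<^bsub>G\<^esub> g'"] g g' by blast
  have m_eq: "conj_by G m x = conj_by G (inv\<^bsub>G\<^esub> g') (conj_by G g x)" if "x \<in> carrier G" for x
    using m(2)[OF that] conj_by_mult[of g "inv\<^bsub>G\<^esub> g'" x] that g g' by simp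
  have "conj_by G m ` generate G P = conj_by G (inv\<^bsub>G\<^esub> g') ` conj_by G g ` generate G P"
    unfolding image_image using generate_G[OF P] m_eq by (intro image_cong) auto
  also have "\<dots> = (\<lambda>x. x) ` generate G P'"
    unfolding eq image_image using generate_G[OF P'] inv_g' by (intro image_cong) auto
  finally have "conj_by G m (central_elt P) = central_elt P'"
    using conj_by_central_elt[OF P P' m(1)] by simp
  moreover have zP: "central_elt P \<in> carrier G" using central_elt(3)[OF P] parabolic_G[OF P] by blast
  ultimately have "conj_by G (inv\<^bsub>G\<^esub> g') (conj_by G g (central_elt P)) = central_elt P'"
    using m_eq by simp
  then have "conj_by G g' (central_elt P') = conj_by G g (central_elt P)"
    using conj_by_inv[of g' "conj_by G g (central_elt P)"] g g' zP conj_by_closed by metis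
  with z show "z = conj_by G g (central_elt P)" by simp
qed

end

theorem proposition30:
  fixes M :: "('a, 'm) monoid_scheme" and G :: "('a, 'g) monoid_scheme"
    and \<Delta> b b' :: 'a and P Q K :: "'a set"
  assumes "garside_monoid M \<Delta>"
    and "\<And>S\<^sub>1. S\<^sub>1 \<subseteq> atoms M \<Longrightarrow>
           is_right_lcm_set M S\<^sub>1 (head M (standard_parabolic M hull S\<^sub>1) \<Delta>)"
    and "\<exists>n::nat. 0 < n \<and> centralizes M (carrier M) (\<Delta> [^]\<^bsub>M\<^esub> n)"
    and "\<And>P'. standard_parabolic M P' \<Longrightarrow>
           \<exists>n::nat. 0 < n \<and> centralizes M P' (head M P' \<Delta> [^]\<^bsub>M\<^esub> n)"
    and "group_of_fractions M G"
    and "standard_parabolic M P"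
    and "b \<in> carrier M"
    and "K = conj_by G b ` generate G P"
    and "b' \<in> carrier M"
    and "head M P b \<otimes>\<^bsub>M\<^esub> max_ribbon M P (tail M P b) \<otimes>\<^bsub>M\<^esub> b' = b"
    and "Q = conj_by G (max_ribbon M P (tail M P b)) ` P"
  shows "reduced_fraction M G (parabolic_z M \<Delta> G K)
           b' (least_central_power M Q (head M Q \<Delta>) \<otimes>\<^bsub>M\<^esub> b')"
proof -
  interpret lcm_garside_fractions M \<Delta> G
    using assms(1,2,4,5)
    by (intro lcm_garside_fractions.intro lcm_garside_monoid.intro lcm_garside_monoid_axioms.intro
        lcm_garside_fractions_axioms.intro)
  note P = assms(6) and b = assms(7) and b' = assms(9)
  have Q: "Q = conjugate_set P (max_ribbon M P (tail M P b))"
    unfolding assms(11) by (rule conj_by_ribbon_image[OF P max_ribbon(1)[OF P tail(2)[OF P b]]])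
  note D = ribbon_decomposition[OF P b b' assms(10), folded Q]
  have "parabolic_z M \<Delta> G K = inv\<^bsub>G\<^esub> b' \<otimes>\<^bsub>G\<^esub> (central_elt Q \<otimes>\<^bsub>M\<^esub> b')"
    unfolding assms(8) parabolic_z_eq[OF P M_G[OF b]] D(4)
    by (rule conj_by_central_elt_eq_fraction[OF D(1) b'])
  moreover have "central_elt Q \<otimes>\<^bsub>M\<^esub> b' \<in> carrier M"
    using central_elt(3)[OF D(1)] parabolic_carrier[OF D(1)] b' by simp
  ultimately show ?thesis
    using D(2) b' by (simp add: reduced_fraction_def)
qed

end
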